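(* Let $\mathbb{X}$ be $\mathbb{R}^n$, $\mathbb{S}^n$ or $\mathbb{H}^n$. Let $F:\mathbb{R}^m_+\to\mathbb{R}$ be a supermodular Borel measurable function with $F(\mathbf{0})=0$, and let $u_1,\dots,u_m$ be nonnegative measurable functions on $\mathbb{X}$ that vanish at infinity. Assume that the negative part $F_-$ of $F$ satisfies $$\int_{\mathbb{X}} F_-\bigl(u_i(x)\,\mathbf{e}_i\bigr)\,dx<\infty\qquad\text{for } i=1,\dots,m.$$ Then $$\int_{\mathbb{X}} F(u_1(x),\dots,u_m(x))\,dx\ \le\ \int_{\mathbb{X}} F(u_1^*(x),\dots,u_m^*(x))\,dx .$$ Suppose moreover that this inequality holds with equality and that the integrals are finite. If for some $i\neq j$ the strict inequality $$F(\mathbf{y}+h\mathbf{e}_i+k\mathbf{e}_j)+F(\mathbf{y})>F(\mathbf{y}+h\mathbf{e}_i)+F(\mathbf{y}+k\mathbf{e}_j)$$ holds for all $\mathbf{y}\in\mathbb{R}^m_+$ and all $h,k>0$, then $$\bigl(u_i(x)-u_i(x')\bigr)\bigl(u_j(x)-u_j(x')\bigr)\ge 0\qquad\text{for almost all } x,x'\in\mathbb{X};$$ in particular, if $u_i=u_i^*$ is strictly radially decreasing, then $u_j=u_j^*$.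
   Context: $\mathbb{X}$ is the Euclidean space $\mathbb{R}^n$, the sphere $\mathbb{S}^n$, or the hyperbolic space $\mathbb{H}^n$, with its standard distance $d(\cdot,\cdot)$ and uniform (Riemannian) volume measure $\lambda$; $dx$ denotes integration with respect to $\lambda$. A distinguished point $x^*\in\mathbb{X}$ (origin or north pole) is fixed. $\mathbb{R}_+=[0,\infty)$, $\mathbb{R}^m_+$ is the closed positive cone, $\mathbf{e}_i$ is the $i$-th standard basis vector of $\mathbb{R}^m$, and $F_-=\max\{-F,0\}$. A function $F:\mathbb{R}^m_+\to\mathbb{R}$ is supermodular if $F(\mathbf{y}+h\mathbf{e}_i+k\mathbf{e}_j)+F(\mathbf{y})\ge F(\mathbf{y}+h\mathbf{e}_i)+F(\mathbf{y}+k\mathbf{e}_j)$ for all $\mathbf{y}\in\mathbb{R}^m_+$, all $i\ne j$ and all $h,k>0$. A nonnegative measurable function $u$ on $\mathbb{R}^n$ or $\mathbb{H}^n$ vanishes at infinity if $\lambda(\{x: u(x)>t\})<\infty$ for all $t>0$; on $\mathbb{S}^n$ the requirement is void. The symmetric decreasing rearrangement $u^*$ of $u$ is the upper semicontinuous, nonincreasing function of $d(x,x^* )$ that is equimeasurable with $u$; explicitly $u^*(x)=\sup\{t\ge 0:\ \rho(t)\ge\lambda(B_{d(x,x^* )})\}$, where $\rho(t)=\lambda(\{x\in\mathbb{X}:u(x)>t\})$ and $B_r$ is the open ball of radius $r$ centered at $x^*$ (the value at the single point $x=x^*$ is immaterial). "Strictly radially decreasing" means a strictly decreasing function of $d(x,x^*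 )$. Equalities between functions are understood almost everywhere. The hypotheses ensure that both integrals in the inequality are well-defined, with values in $(-\infty,+\infty]$. *)

theory Defs
  imports "HOL-Analysis.Analysis"
begin

record 'a pointed_space =
  volume :: "'a measure"
  distance :: "'a \<Rightarrow> 'a \<Rightarrow> real"
  basepoint :: 'a

abbreviation points :: "'a pointed_space \<Rightarrow> 'a set" where
  "points X \<equiv> space (volume X)"

text \<open>The volume measures are complete, so that measurable means Lebesgue measurable.\<close>

definition euclidean_model :: "(real ^ 'n) pointed_space" where
  "euclidean_model = \<lparr>volume = lebesgue, distance = dist, basepoint = 0\<rparr>"

text \<open>
  The round sphere. Inverse stereographic projection from the south pole covers all of it except
  the south pole, a null set. In this chart the round metric is
  \<open>4 |dy|\<^sup>2 / (1 + |y|\<^sup>2)\<^sup>2\<close>, which gives the Riemannian volume density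
  \<open>(2 / (1 + |y|\<^sup>2)) ^ n\<close>.
\<close>

definition inverse_stereographic :: "real ^ 'n \<Rightarrow> (real ^ 'n) \<times> real" where
  "inverse_stereographic y =
     ((2 / (1 + (norm y)\<^sup>2)) *\<^sub>R y, (1 - (norm y)\<^sup>2) / (1 + (norm y)\<^sup>2))"

lemma inverse_stereographic_in_sphere: "inverse_stereographic y \<in> sphere 0 1"
proof -
  define s where "s = (norm y)\<^sup>2"
  have s: "0 \<le> s" by (simp add: s_def)
  have "(2 / (1 + s))\<^sup>2 * s + ((1 - s) / (1 + s))\<^sup>2 = 1"
    using s by (simp add: power_divide add_divide_distrib[symmetric])
      (simp add: power2_eq_square algebra_simps)
  then show ?thesis
    by (simp add: inverse_stereographic_def norm_Pair s_def power_mult_distrib power_divide)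
qed

definition spherical_model :: "((real ^ 'n) \<times> real) pointed_space" where
  "spherical_model =
     \<lparr>volume = completion
        (distr (density lborel (\<lambda>y :: real ^ 'n. ennreal ((2 / (1 + (norm y)\<^sup>2)) ^ CARD('n))))
           (restrict_space borel (sphere 0 1)) inverse_stereographic),
      distance = (\<lambda>x y. arccos (x \<bullet> y)),
      basepoint = (0, 1)\<rparr>"

text \<open>
  The Poincare ball model of hyperbolic space, with metric
  \<open>4 |dy|\<^sup>2 / (1 - |y|\<^sup>2)\<^sup>2\<close> of constant curvature \<open>-1\<close>.
\<close>

definition hyperbolic_model :: "(real ^ 'n) pointed_space" where
  "hyperbolic_model =
     \<lparr>volume = density (lebesgue_on (ball 0 1))
        (\<lambda>y. ennreal ((2 / (1 - (norm y)\<^sup>2)) ^ CARD('n))),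
      distance =
        (\<lambda>x y. arcosh (1 + 2 * (norm (x - y))\<^sup>2 / ((1 - (norm x)\<^sup>2) * (1 - (norm y)\<^sup>2)))),
      basepoint = 0\<rparr>"

text \<open>
  Pointed isometry preserving measurable sets and volume. Through this relation a space may be
  given in any of its usual models, on any carrier type.
\<close>

definition isomorphic :: "'a pointed_space \<Rightarrow> 'b pointed_space \<Rightarrow> bool" where
  "isomorphic X Y \<longleftrightarrow>
     basepoint X \<in> points X \<and>
     (\<exists>\<phi> \<psi>. \<phi> \<in> volume X \<rightarrow>\<^sub>M volume Y \<and> \<psi> \<in> volume Y \<rightarrow>\<^sub>M volume X \<and>
        (\<forall>x\<in>points X. \<psi> (\<phi> x) = x) \<and> (\<forall>y\<in>points Y. \<phi> (\<psi> y) = y) \<and>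
        distr (volume X) (volume Y) \<phi> = volume Y \<and>
        (\<forall>x\<in>points X. \<forall>x'\<in>points X. distance Y (\<phi> x) (\<phi> x') = distance X x x') \<and>
        \<phi> (basepoint X) = basepoint Y)"

definition nonneg_cone :: "(real ^ 'm) set" where
  "nonneg_cone = {y. \<forall>i. 0 \<le> y $ i}"

definition supermodular :: "(real ^ 'm \<Rightarrow> real) \<Rightarrow> bool" where
  "supermodular F \<longleftrightarrow>
     (\<forall>y\<in>nonneg_cone. \<forall>i j. i \<noteq> j \<longrightarrow> (\<forall>h>0. \<forall>k>0.
        F (y + h *\<^sub>R axis i 1 + k *\<^sub>R axis j 1) + F y
          \<ge> F (y + h *\<^sub>R axis i 1) + F (y + k *\<^sub>R axis j 1)))"

definition strictly_supermodular_in :: "(real ^ 'm \<Rightarrow> real) \<Rightarrow> 'm \<Rightarrow> 'm \<Rightarrow> bool" where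
  "strictly_supermodular_in F i j \<longleftrightarrow>
     (\<forall>y\<in>nonneg_cone. \<forall>h>0. \<forall>k>0.
        F (y + h *\<^sub>R axis i 1 + k *\<^sub>R axis j 1) + F y
          > F (y + h *\<^sub>R axis i 1) + F (y + k *\<^sub>R axis j 1))"

text \<open>On a space of finite volume, such as the sphere, this condition always holds.\<close>

definition vanishes_at_infinity :: "'a pointed_space \<Rightarrow> ('a \<Rightarrow> real) \<Rightarrow> bool" where
  "vanishes_at_infinity X u \<longleftrightarrow>
     (\<forall>t>0. emeasure (volume X) {x \<in> points X. u x > t} < \<infinity>)"

definition base_ball :: "'a pointed_space \<Rightarrow> real \<Rightarrow> 'a set" where
  "base_ball X r = {x \<in> points X. distance X x (basepoint X) < r}"

text \<open>
  The supremum is taken in \<open>[0, \<infinity>]\<close>, so that it is \<open>0\<close> for the empty set. It is finite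
  away from the base point if \<open>u\<close> vanishes at infinity; at the base point, where it is infinite,
  \<^const>\<open>enn2real\<close> assigns the value \<open>0\<close>.
\<close>

definition rearrangement :: "'a pointed_space \<Rightarrow> ('a \<Rightarrow> real) \<Rightarrow> 'a \<Rightarrow> real" where
  "rearrangement X u x = enn2real
     (SUP t\<in>{t. 0 \<le> t \<and> emeasure (volume X) {z \<in> points X. u z > t}
                       \<ge> emeasure (volume X) (base_ball X (distance X x (basepoint X)))}.
        ennreal t)"

text \<open>The value at the base point is disregarded.\<close>

definition strictly_radially_decreasing :: "'a pointed_space \<Rightarrow> ('a \<Rightarrow> real) \<Rightarrow> bool" where
  "strictly_radially_decreasing X f \<longleftrightarrow>
     (\<forall>x\<in>points X - {basepoint X}. \<forall>x'\<in>points X - {basepoint X}.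
        (distance X x (basepoint X) = distance X x' (basepoint X) \<longrightarrow> f x = f x') \<and>
        (distance X x (basepoint X) < distance X x' (basepoint X) \<longrightarrow> f x > f x'))"

text \<open>
  Integral with values in the extended reals; meaningful when at most one of the two terms is
  infinite. The function \<^const>\<open>ennreal\<close> truncates negative values to \<open>0\<close>.
\<close>

definition extended_integral :: "'a measure \<Rightarrow> ('a \<Rightarrow> real) \<Rightarrow> ereal" where
  "extended_integral M f =
     enn2ereal (\<integral>\<^sup>+x. ennreal (f x) \<partial>M) - enn2ereal (\<integral>\<^sup>+x. ennreal (- f x) \<partial>M)"

end

theory Submission
  imports Defs
begin

text \<open>
  The inequality is proved by duality. Subtracting the values of \<open>F\<close> on the coordinate axes
  leaves a supermodular function \<open>\<Phi>\<close> that vanishes on the axes, hence is nonnegative and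
  nondecreasing; the subtracted terms \<open>F (u\<^sub>i e\<^sub>i)\<close> involve one \<open>u\<^sub>i\<close> at a time, so their
  integrals do not change under rearrangement. What remains is
  \<open>\<integral> \<Phi>(u) \<le> \<integral> \<Phi>(u\<^sup>*)\<close>.

  The functions \<open>u\<^sub>i\<^sup>*\<close> are all nonincreasing in the same variable, so the values of \<open>u\<^sup>*\<close> form a
  chain in the cone. For every chain there is a separable majorant
  \<open>\<Phi>(y) \<le> \<Sum>\<^sub>i f\<^sub>i(y\<^sub>i)\<close> with equality on the chain (\<open>chain_certificate\<close>): one walks along the
  chain raising a single coordinate at a time and lets \<open>f\<^sub>i\<close> record the increments of \<open>\<Phi>\<close> in
  direction \<open>i\<close>; supermodularity says that at any other point these increments are no larger
  than on the chain where the remaining coordinates are larger. For a finite chain this is an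
  induction, and compactness of a product of copies of \<open>[0, \<infinity>]\<close> passes to arbitrary chains. Then
  \<open>\<integral> \<Phi>(u) \<le> \<Sum>\<^sub>i \<integral> f\<^sub>i(u\<^sub>i) = \<Sum>\<^sub>i \<integral> f\<^sub>i(u\<^sub>i\<^sup>*) = \<integral> \<Phi>(u\<^sup>*)\<close>,
  where the middle step is equimeasurability.

  In the case of equality with finite integrals, \<open>u(x)\<close> lies for almost every \<open>x\<close> in the set where
  \<open>\<Phi>\<close> touches its majorant. If \<open>a\<close> and \<open>b\<close> are in this set, the majorant has the same total at
  \<open>a, b\<close> as at \<open>sup a b, inf a b\<close>, so \<open>\<Phi>(sup a b) + \<Phi>(inf a b) \<le> \<Phi>(a) + \<Phi>(b)\<close>. Strict
  supermodularity in directions \<open>i, j\<close> forbids this when \<open>a - b\<close> has entries of opposite signs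
  there (\<open>separable_contact_ordered\<close>). If moreover \<open>u\<^sub>i\<close> is strictly radially decreasing, then \<open>u\<^sub>j\<close>
  is ordered by the radius as well, so that each of its superlevel sets is comparable by inclusion
  to the ball of the same volume and must coincide with it up to a null set.

  Geometry enters only through the volume \<open>V(x)\<close> of the ball around the base point whose boundary
  contains \<open>x\<close>. Spheres are null sets and balls have finite volume, and this suffices for
  \<open>\<lambda>({V < c}) = c\<close> for all \<open>c\<close> up to the total volume (\<open>emeasure_enclosed_less\<close>), from which the
  equimeasurability of \<open>u\<close> and \<open>u\<^sup>*\<close> follows. These two properties are checked in the three model
  spaces and carried over by isomorphisms.
\<close>

section \<open>Supermodular functions on the cone\<close>

definition overlay :: "'m set \<Rightarrow> real ^ 'm \<Rightarrow> real ^ 'm \<Rightarrow> real ^ 'm" where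
  "overlay Q z y = (\<chi> l. if l \<in> Q then z $ l else y $ l)"

definition put :: "'m \<Rightarrow> real \<Rightarrow> real ^ 'm \<Rightarrow> real ^ 'm" where
  "put i t y = (\<chi> l. if l = i then t else y $ l)"

lemma overlay_nth [simp]: "overlay Q z y $ l = (if l \<in> Q then z $ l else y $ l)"
  by (simp add: overlay_def)

lemma put_nth [simp]: "put i t y $ l = (if l = i then t else y $ l)"
  by (simp add: put_def)

lemma overlay_empty [simp]: "overlay {} z y = y"
  by (simp add: vec_eq_iff)

lemma overlay_insert: "overlay (insert i Q) z y = put i (z $ i) (overlay Q z y)"
  by (simp add: vec_eq_iff)

lemma overlay_remove: "i \<in> Q \<Longrightarrow> overlay Q z y = overlay (Q - {i}) z (put i (z $ i) y)"
  by (simp add: vec_eq_iff)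

lemma put_same [simp]: "put i (y $ i) y = y"
  by (simp add: vec_eq_iff)

lemma put_overlay_commute: "i \<notin> Q \<Longrightarrow> put i t (overlay Q z y) = overlay Q z (put i t y)"
  by (auto simp: vec_eq_iff)

lemma zero_in_cone [simp]: "0 \<in> nonneg_cone"
  by (simp add: nonneg_cone_def)

lemma cone_nth: "y \<in> nonneg_cone \<Longrightarrow> 0 \<le> y $ i"
  by (simp add: nonneg_cone_def)

lemma overlay_in_cone: "y \<in> nonneg_cone \<Longrightarrow> z \<in> nonneg_cone \<Longrightarrow> overlay Q z y \<in> nonneg_cone"
  by (simp add: nonneg_cone_def)

lemma put_in_cone: "y \<in> nonneg_cone \<Longrightarrow> 0 \<le> t \<Longrightarrow> put i t y \<in> nonneg_cone"
  by (simp add: nonneg_cone_def)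

lemma put_eq_add_axis:
  "put i t y = y + (t - y $ i) *\<^sub>R axis i 1"
  by (simp add: vec_eq_iff axis_def)

lemma put_put_eq_add_axis:
  assumes "i \<noteq> j"
  shows "put i s (put j t y) = y + (s - y $ i) *\<^sub>R axis i 1 + (t - y $ j) *\<^sub>R axis j 1"
  using assms by (simp add: vec_eq_iff axis_def)

lemma supermodular_put:
  assumes "supermodular F" "y \<in> nonneg_cone" "i \<noteq> j" "y $ i \<le> s" "y $ j \<le> t"
  shows "F (put i s y) + F (put j t y) \<le> F (put i s (put j t y)) + F y"
proof -
  consider "s = y $ i" | "t = y $ j" | "s - y $ i > 0" "t - y $ j > 0"
    using assms by linarith
  then show ?thesis
  proof cases
    case 1
    have "put i s (put j t y) = put j t y"
      using 1 assms(3) by (simp add: vec_eq_iff)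
    with 1 show ?thesis by simp
  next
    case 3
    then show ?thesis
      using assms unfolding supermodular_def put_put_eq_add_axis[OF assms(3)]
      by (metis put_eq_add_axis)
  qed simp
qed

lemma strictly_supermodular_put:
  assumes "strictly_supermodular_in F i j" "y \<in> nonneg_cone" "i \<noteq> j" "y $ i < s" "y $ j < t"
  shows "F (put i s y) + F (put j t y) < F (put i s (put j t y)) + F y"
proof -
  have "s - y $ i > 0" "t - y $ j > 0"
    using assms by auto
  then show ?thesis
    using assms unfolding strictly_supermodular_in_def put_put_eq_add_axis[OF assms(3)]
    by (metis put_eq_add_axis)
qed

text \<open>
  Iterating the two-coordinate inequality over the coordinates in \<open>Q\<close>: the increment of \<open>F\<close> in
  direction \<open>i\<close> grows when other coordinates are raised.
\<close>

lemma increment_mono: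
  assumes F: "supermodular F" and y: "y \<in> nonneg_cone"
    and i: "i \<notin> Q" "y $ i \<le> t" and z: "\<And>l. l \<in> Q \<Longrightarrow> y $ l \<le> z $ l"
  shows "F (put i t y) - F y \<le> F (put i t (overlay Q z y)) - F (overlay Q z y)"
proof -
  have "finite Q" by simp
  then show ?thesis using i(1) z
  proof (induction Q)
    case (insert j Q)
    let ?y = "overlay Q z y"
    have y': "?y \<in> nonneg_cone"
      using y insert.prems(2) by (simp add: nonneg_cone_def) (meson order_trans)
    have "F (put i t ?y) + F (put j (z $ j) ?y) \<le> F (put i t (put j (z $ j) ?y)) + F ?y"
      using insert i(2) by (intro supermodular_put F y') auto
    then show ?case
      using insert by (fastforce simp: overlay_insert)
  qed simp
qed

lemma overlay_mono:
  assumes F: "supermodular F" and y: "y \<in> nonneg_cone" and disj: "R \<inter> Q = {}"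
    and w: "\<And>l. l \<in> R \<Longrightarrow> y $ l \<le> w $ l" and z: "\<And>l. l \<in> Q \<Longrightarrow> y $ l \<le> z $ l"
  shows "F (overlay R w y) - F y \<le> F (overlay R w (overlay Q z y)) - F (overlay Q z y)"
proof -
  have "finite R" by simp
  then show ?thesis using disj w
  proof (induction R)
    case (insert i R)
    let ?y = "overlay R w y"
    have y': "?y \<in> nonneg_cone"
      using y insert.prems(2) by (simp add: nonneg_cone_def) (meson order_trans)
    have c: "overlay R w (overlay Q z y) = overlay Q z ?y"
      using insert.prems(1) by (auto simp: vec_eq_iff)
    have "F (put i (w $ i) ?y) - F ?y \<le> F (put i (w $ i) (overlay Q z ?y)) - F (overlay Q z ?y)"
    proof (rule increment_mono[OF F y'])
      show "?y $ l \<le> z $ l" if "l \<in> Q" for l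
        using that z insert.prems(1) by auto
    qed (use insert in auto)
    then show ?case
      using insert by (fastforce simp: overlay_insert c)
  qed simp
qed

lemma increment_strict_mono:
  assumes F: "supermodular F" "strictly_supermodular_in F i j" and y: "y \<in> nonneg_cone"
    and i: "i \<notin> Q" "y $ i < t" and z: "\<And>l. l \<in> Q \<Longrightarrow> y $ l \<le> z $ l"
    and j: "j \<in> Q" "y $ j < z $ j"
  shows "F (put i t y) - F y < F (put i t (overlay Q z y)) - F (overlay Q z y)"
proof -
  let ?y = "put j (z $ j) y"
  have y': "?y \<in> nonneg_cone"
    using y j by (intro put_in_cone) (auto dest: cone_nth[of _ j])
  have "F (put i t y) + F ?y < F (put i t ?y) + F y"
    using i j by (intro strictly_supermodular_put F y) auto
  moreover have "F (put i t ?y) - F ?y \<le> F (put i t (overlay (Q - {j}) z ?y)) - F (overlay (Q - {j}) z ?y)"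
    using i j z by (intro increment_mono F y') auto
  ultimately show ?thesis
    using j by (simp add: overlay_remove)
qed

text \<open>
  The strict gain comes from raising \<open>i\<close> in the presence of \<open>j\<close>; the remaining coordinates in \<open>R\<close>
  contribute weakly.
\<close>

lemma overlay_strict_mono:
  assumes F: "supermodular F" "strictly_supermodular_in F i j" and y: "y \<in> nonneg_cone"
    and disj: "R \<inter> Q = {}"
    and w: "\<And>l. l \<in> R \<Longrightarrow> y $ l \<le> w $ l" and z: "\<And>l. l \<in> Q \<Longrightarrow> y $ l \<le> z $ l"
    and i: "i \<in> R" "y $ i < w $ i" and j: "j \<in> Q" "y $ j < z $ j"
  shows "F (overlay R w y) - F y < F (overlay R w (overlay Q z y)) - F (overlay Q z y)"
proof -
  let ?y = "put i (w $ i) y"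
  have y': "?y \<in> nonneg_cone"
    using y i by (intro put_in_cone) (auto dest: cone_nth[of _ i])
  have c: "put i (w $ i) (overlay Q z y) = overlay Q z ?y"
    using i disj by (intro put_overlay_commute) auto
  have "F ?y - F y < F (overlay Q z ?y) - F (overlay Q z y)"
    unfolding c[symmetric] using i j disj by (intro increment_strict_mono[where j = j] F y z) auto
  moreover have "F (overlay (R - {i}) w ?y) - F ?y
      \<le> F (overlay (R - {i}) w (overlay Q z ?y)) - F (overlay Q z ?y)"
    using i disj z w by (intro overlay_mono F y') auto
  ultimately show ?thesis
    using i by (simp add: overlay_remove[of i R] c)
qed

lemma inf_vec_nth: "inf a b $ l = min (a $ l) (b $ l)" for a b :: "real ^ 'm"
  by (simp add: inf_vec_def inf_min)

lemma sup_vec_nth: "sup a b $ l = max (a $ l) (b $ l)" for a b :: "real ^ 'm"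
  by (simp add: sup_vec_def sup_max)

lemma sup_in_cone: "a \<in> nonneg_cone \<Longrightarrow> b \<in> nonneg_cone \<Longrightarrow> sup a b \<in> nonneg_cone"
  by (simp add: nonneg_cone_def sup_vec_nth le_max_iff_disj)

lemma inf_in_cone: "a \<in> nonneg_cone \<Longrightarrow> b \<in> nonneg_cone \<Longrightarrow> inf a b \<in> nonneg_cone"
  by (simp add: nonneg_cone_def inf_vec_nth)

lemma
  fixes a b :: "real ^ 'm"
  defines "R \<equiv> {l. b $ l < a $ l}" and "Q \<equiv> {l. a $ l < b $ l}"
  shows overlay_inf_left: "overlay R a (inf a b) = a"
    and overlay_inf_right: "overlay Q b (inf a b) = b"
    and overlay_sup: "overlay R a b = sup a b"
  unfolding R_def Q_def by (auto simp: vec_eq_iff inf_vec_nth sup_vec_nth)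

text \<open>
  With \<open>R\<close> and \<open>Q\<close> the sets of coordinates where \<open>a\<close> respectively \<open>b\<close> is larger, the points \<open>a\<close>,
  \<open>b\<close> and \<open>sup a b\<close> arise from \<open>inf a b\<close> by raising the coordinates in \<open>R\<close>, in \<open>Q\<close>, and in both.
\<close>

lemma strictly_supermodular_inf_sup:
  assumes F: "supermodular F" "strictly_supermodular_in F i j"
    and a: "a \<in> nonneg_cone" and b: "b \<in> nonneg_cone"
    and ij: "b $ i < a $ i" "a $ j < b $ j"
  shows "F a + F b < F (sup a b) + F (inf a b)"
proof -
  let ?R = "{l. b $ l < a $ l}" and ?Q = "{l. a $ l < b $ l}"
  have "?R \<inter> ?Q = {}" by auto
  then have "F (overlay ?R a (inf a b)) - F (inf a b)
      < F (overlay ?R a (overlay ?Q b (inf a b))) - F (overlay ?Q b (inf a b))"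
    using ij by (intro overlay_strict_mono[OF F inf_in_cone[OF a b]]) (auto simp: inf_vec_nth)
  then show ?thesis
    by (simp add: overlay_inf_left overlay_inf_right overlay_sup)
qed

text \<open>
  Passing to the excess over the axes makes a supermodular function nonnegative and nondecreasing
  without affecting (strict) supermodularity, since separable functions satisfy the defining
  inequality with equality.
\<close>

definition excess :: "(real ^ 'm \<Rightarrow> real) \<Rightarrow> real ^ 'm \<Rightarrow> real" where
  "excess F y = F y - (\<Sum>i\<in>UNIV. F (axis i (y $ i)))"

lemma separable_modular:
  fixes g :: "'m::finite \<Rightarrow> real \<Rightarrow> real"
  assumes "i \<noteq> j"
  shows "(\<Sum>l\<in>UNIV. g l ((y + h *\<^sub>R axis i 1 + k *\<^sub>R axis j 1) $ l)) + (\<Sum>l\<in>UNIV. g l (y $ l))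
    = (\<Sum>l\<in>UNIV. g l ((y + h *\<^sub>R axis i 1) $ l)) + (\<Sum>l\<in>UNIV. g l ((y + k *\<^sub>R axis j 1) $ l))"
  unfolding sum.distrib[symmetric] using assms by (intro sum.cong) (auto simp: axis_def)

lemma supermodular_excess:
  fixes F :: "real ^ 'm \<Rightarrow> real"
  assumes "supermodular F"
  shows "supermodular (excess F)"
  unfolding supermodular_def
proof (intro ballI allI impI)
  fix y :: "real ^ 'm" and i j :: 'm and h k :: real
  assume "y \<in> nonneg_cone" "i \<noteq> j" "0 < h" "0 < k"
  with assms separable_modular[OF this(2), of "\<lambda>l t. F (axis l t)" y h k]
  show "excess F (y + h *\<^sub>R axis i 1) + excess F (y + k *\<^sub>R axis j 1)
      \<le> excess F (y + h *\<^sub>R axis i 1 + k *\<^sub>R axis j 1) + excess F y"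
    unfolding supermodular_def excess_def by smt
qed

lemma strictly_supermodular_excess:
  fixes F :: "real ^ 'm \<Rightarrow> real"
  assumes "strictly_supermodular_in F i j" "i \<noteq> j"
  shows "strictly_supermodular_in (excess F) i j"
  unfolding strictly_supermodular_in_def
proof (intro ballI allI impI)
  fix y :: "real ^ 'm" and h k :: real
  assume "y \<in> nonneg_cone" "0 < h" "0 < k"
  with assms separable_modular[OF assms(2), of "\<lambda>l t. F (axis l t)" y h k]
  show "excess F (y + h *\<^sub>R axis i 1) + excess F (y + k *\<^sub>R axis j 1)
      < excess F (y + h *\<^sub>R axis i 1 + k *\<^sub>R axis j 1) + excess F y"
    unfolding strictly_supermodular_in_def excess_def by smt
qed

lemma excess_axis:
  assumes "F 0 = 0"
  shows "excess F (axis i t) = 0"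
proof -
  have "F (axis l (axis i t $ l)) = (if l = i then F (axis i t) else 0)" for l
    using assms axis_eq_0_iff[of l 0] by (auto simp: axis_def vec_eq_iff zero_vec_def[symmetric])
  then show ?thesis
    by (simp add: excess_def)
qed

text \<open>
  The increment in direction \<open>i\<close> is smallest on the axis itself, where it is \<open>0\<close>.
\<close>

lemma put_mono_of_zero_on_axes:
  assumes F: "supermodular F" and ax: "\<And>i t. F (axis i t) = 0" and y: "y \<in> nonneg_cone"
    and t: "y $ i \<le> t"
  shows "F y \<le> F (put i t y)"
proof -
  let ?a = "axis i (y $ i)"
  have m: "overlay (UNIV - {i}) y ?a = y"
    by (auto simp: vec_eq_iff axis_def)
  have p: "put i t ?a = axis i t"
    by (auto simp: vec_eq_iff axis_def)
  have "F (put i t ?a) - F ?a \<le> F (put i t y) - F y"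
  proof -
    have "F (put i t ?a) - F ?a
      \<le> F (put i t (overlay (UNIV - {i}) y ?a)) - F (overlay (UNIV - {i}) y ?a)"
      using y t by (intro increment_mono F) (auto simp: nonneg_cone_def axis_def)
    then show ?thesis
      by (simp only: m)
  qed
  then show ?thesis
    by (simp add: p ax)
qed

lemma nonneg_of_zero_on_axes:
  assumes F: "supermodular F" and ax: "\<And>i t. F (axis i t) = 0" and y: "y \<in> nonneg_cone"
  shows "0 \<le> F y"
proof -
  have "0 \<le> F (overlay Q y 0)" for Q
  proof -
    have "finite Q" by simp
    then show ?thesis
    proof (induction Q)
      case empty
      show ?case using ax[of undefined 0] by (simp add: axis_eq_0_iff[THEN iffD2])
    next
      case (insert i Q)
      then show ?case
        using put_mono_of_zero_on_axes[OF F ax overlay_in_cone[OF zero_in_cone y], of Q i "y $ i"]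
          cone_nth[OF y] by (simp add: overlay_insert)
    qed
  qed
  from this[of UNIV] show ?thesis
    by (simp add: overlay_def)
qed

section \<open>Separable majorants\<close>

text \<open>
  Majorants take values in \<open>[0, \<infinity>]\<close>. The value \<open>\<infinity>\<close> serves to state the bound on the
  whole cone even where the chain gives no information, and it makes the space of candidates
  compact. Monotonicity makes the \<open>f\<^sub>i\<close> Borel functions.
\<close>

definition dominates :: "('m \<Rightarrow> real \<Rightarrow> ennreal) \<Rightarrow> (real ^ 'm \<Rightarrow> real) \<Rightarrow> bool" where
  "dominates f \<Phi> \<longleftrightarrow> (\<forall>i. mono (f i)) \<and> (\<forall>i. f i 0 = 0) \<and>
     (\<forall>y\<in>nonneg_cone. ennreal (\<Phi> y) \<le> (\<Sum>i\<in>UNIV. f i (y $ i)))"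

text \<open>
  Together with \<open>dominates\<close> this is equality at a point \<open>y\<close> of the cone.
\<close>

definition tight_at :: "('m \<Rightarrow> real \<Rightarrow> ennreal) \<Rightarrow> (real ^ 'm \<Rightarrow> real) \<Rightarrow> real ^ 'm \<Rightarrow> bool" where
  "tight_at f \<Phi> y \<longleftrightarrow> (\<Sum>i\<in>UNIV. f i (y $ i)) \<le> ennreal (\<Phi> y)"

definition infinite_beyond :: "('m \<Rightarrow> real \<Rightarrow> ennreal) \<Rightarrow> real ^ 'm \<Rightarrow> bool" where
  "infinite_beyond f c \<longleftrightarrow> (\<forall>i t. c $ i < t \<longrightarrow> f i t = \<infinity>)"

lemma sum_put:
  fixes f :: "'m::finite \<Rightarrow> real \<Rightarrow> ennreal"
  shows "(\<Sum>l\<in>UNIV. f l (put i t y $ l)) = f i t + (\<Sum>l\<in>UNIV - {i}. f l (y $ l))"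
  by (subst sum.remove[of UNIV i]) auto

text \<open>
  The inductive step. The majorant is tight at \<open>c\<close> and so far carries no information beyond \<open>c\<close>.
  On the segment from \<open>c\<close> in direction \<open>i\<close> the new \<open>f\<^sub>i\<close> copies \<open>\<Phi>\<close>. A point \<open>y\<close> of the newly
  covered region differs in coordinate \<open>i\<close> only from a point \<open>y'\<close> covered before, and its other
  coordinates are below those of \<open>c\<close>, so that the increment of \<open>\<Phi>\<close> from \<open>y'\<close> to \<open>y\<close> is at most the
  increment along the segment.
\<close>

lemma dominates_extend_coordinate:
  assumes \<Phi>: "supermodular \<Phi>" "\<And>i t. \<Phi> (axis i t) = 0"
    and c: "c \<in> nonneg_cone" and b: "c $ i \<le> b"
    and f: "dominates f \<Phi>" "tight_at f \<Phi> c" "infinite_beyond f c"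
  obtains g where "dominates g \<Phi>" "tight_at g \<Phi> (put i b c)" "infinite_beyond g (put i b c)"
    "\<And>l t. t \<le> c $ l \<Longrightarrow> g l t = f l t"
proof -
  \<comment> \<open>Beyond \<open>b\<close> there is no information yet, whence the value \<open>\<infinity>\<close>.\<close>
  define h where "h t = (if t \<le> c $ i then f i t
    else if t \<le> b then f i (c $ i) + ennreal (\<Phi> (put i t c) - \<Phi> c) else \<infinity>)" for t
  define g where "g = f(i := h)"
  have pc: "put i t c \<in> nonneg_cone" if "c $ i \<le> t" for t
    using c that cone_nth[OF c, of i] by (intro put_in_cone) auto
  have inc: "\<Phi> (put i s c) \<le> \<Phi> (put i t c)" if "c $ i \<le> s" "s \<le> t" for s t
  proof -
    have "put i t (put i s c) = put i t c"
      by (simp add: vec_eq_iff)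
    then show ?thesis
      using put_mono_of_zero_on_axes[OF \<Phi> pc[OF that(1)], of i t] that by simp
  qed
  have f_mono: "mono (f l)" and f_0: "f l 0 = 0" for l
    using f by (auto simp: dominates_def)
  have f_dom: "y \<in> nonneg_cone \<Longrightarrow> ennreal (\<Phi> y) \<le> (\<Sum>l\<in>UNIV. f l (y $ l))" for y
    using f by (auto simp: dominates_def)
  have h_mono: "mono h"
  proof (rule monoI)
    fix s t :: real assume "s \<le> t"
    moreover have "f i s \<le> f i (c $ i) + x" if "s \<le> c $ i" for x
      using monoD[OF f_mono that, of i] by (simp add: add_increasing2)
    ultimately show "h s \<le> h t"
      using monoD[OF f_mono, of s t i] inc[of s t]
      by (auto simp: h_def intro!: add_left_mono ennreal_leI)
  qed
  have h_0: "h 0 = 0"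
    using cone_nth[OF c, of i] f_0 by (simp add: h_def)
  have g_dom: "ennreal (\<Phi> y) \<le> (\<Sum>l\<in>UNIV. g l (y $ l))" if y: "y \<in> nonneg_cone" for y
  proof (cases "\<exists>l. put i b c $ l < y $ l")
    case True
    then obtain l where "put i b c $ l < y $ l" by blast
    then have "g l (y $ l) = \<infinity>"
      using f(3) b by (auto simp: g_def h_def infinite_beyond_def split: if_splits)
    then have "(\<Sum>l\<in>UNIV. g l (y $ l)) = \<infinity>"
      by (subst sum.remove[of UNIV l]) auto
    then show ?thesis by (simp only: infinity_ennreal_def top_greatest)
  next
    case False
    then have le: "y $ l \<le> put i b c $ l" for l
      by (meson not_less)
    show ?thesis
    proof (cases "y $ i \<le> c $ i")
      case True
      then have "g l (y $ l) = f l (y $ l)" for l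
        by (auto simp: g_def h_def)
      then show ?thesis using f_dom[OF y] by simp
    next
      case t: False
      define y' where "y' = put i (c $ i) y"
      have y': "y' \<in> nonneg_cone"
        unfolding y'_def using y cone_nth[OF c] by (intro put_in_cone)
      have m: "overlay (UNIV - {i}) c y' = c" and py: "put i (y $ i) y' = y"
        by (auto simp: vec_eq_iff y'_def)
      have "\<Phi> (put i (y $ i) y') - \<Phi> y'
          \<le> \<Phi> (put i (y $ i) (overlay (UNIV - {i}) c y')) - \<Phi> (overlay (UNIV - {i}) c y')"
      proof (rule increment_mono[OF \<Phi>(1) y'])
        show "y' $ l \<le> c $ l" if "l \<in> UNIV - {i}" for l
          using le[of l] that by (simp add: y'_def)
      qed (use t in \<open>auto simp: y'_def\<close>)
      then have "\<Phi> y \<le> \<Phi> y' + (\<Phi> (put i (y $ i) c) - \<Phi> c)"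
        by (simp only: m py)
      then have "ennreal (\<Phi> y) \<le> ennreal (\<Phi> y') + ennreal (\<Phi> (put i (y $ i) c) - \<Phi> c)"
        using nonneg_of_zero_on_axes[OF \<Phi> y'] inc[of "c $ i" "y $ i"] t
        by (subst ennreal_plus[symmetric]) (auto simp del: ennreal_plus intro: ennreal_leI)
      also have "\<dots> \<le> (\<Sum>l\<in>UNIV. f l (y' $ l)) + ennreal (\<Phi> (put i (y $ i) c) - \<Phi> c)"
        using f_dom[OF y'] by (rule add_right_mono)
      also have "\<dots> = h (y $ i) + (\<Sum>l\<in>UNIV - {i}. f l (y $ l))"
        using t le[of i] unfolding y'_def sum_put by (simp add: h_def ac_simps)
      also have "\<dots> = (\<Sum>l\<in>UNIV. g l (y $ l))"
        by (subst sum.remove[of UNIV i "\<lambda>l. g l (y $ l)"]) (auto simp: g_def intro!: sum.cong)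
      finally show ?thesis .
    qed
  qed
  show thesis
  proof
    show "dominates g \<Phi>"
      using g_dom f_mono f_0 h_mono h_0 by (auto simp: dominates_def g_def)
    show "infinite_beyond g (put i b c)"
      using f(3) b by (auto simp: g_def h_def infinite_beyond_def)
    have "(\<Sum>l\<in>UNIV. g l (put i b c $ l)) = h b + (\<Sum>l\<in>UNIV - {i}. f l (c $ l))"
      unfolding sum_put by (simp add: g_def)
    also have "h b = f i (c $ i) + ennreal (\<Phi> (put i b c) - \<Phi> c)"
      using b by (auto simp: h_def)
    also have "f i (c $ i) + ennreal (\<Phi> (put i b c) - \<Phi> c) + (\<Sum>l\<in>UNIV - {i}. f l (c $ l))
       = (\<Sum>l\<in>UNIV. f l (c $ l)) + ennreal (\<Phi> (put i b c) - \<Phi> c)"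
      by (simp add: sum.remove[of UNIV i "\<lambda>l. f l (c $ l)"] ac_simps)
    also have "\<dots> \<le> ennreal (\<Phi> c) + ennreal (\<Phi> (put i b c) - \<Phi> c)"
      using f(2) by (intro add_right_mono) (simp add: tight_at_def)
    also have "\<dots> = ennreal (\<Phi> (put i b c))"
      using nonneg_of_zero_on_axes[OF \<Phi> c] inc[of "c $ i" b] b
      by (subst ennreal_plus[symmetric]) auto
    finally show "tight_at g \<Phi> (put i b c)"
      by (simp add: tight_at_def)
    show "g l t = f l t" if "t \<le> c $ l" for l t
      using that by (auto simp: g_def h_def)
  qed
qed

text \<open>
  Any two comparable points are joined by a path that raises one coordinate at a time. Values at
  or below \<open>c\<close> are kept, so that tightness at earlier points of the chain persists.
\<close>

lemma dominates_extend:
  assumes \<Phi>: "supermodular \<Phi>" "\<And>i t. \<Phi> (axis i t) = 0"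
    and c: "c \<in> nonneg_cone" and le: "c \<le> d"
    and f: "dominates f \<Phi>" "tight_at f \<Phi> c" "infinite_beyond f c"
  obtains g where "dominates g \<Phi>" "tight_at g \<Phi> d" "infinite_beyond g d"
    "\<And>l t. t \<le> c $ l \<Longrightarrow> g l t = f l t"
proof -
  have le': "c $ l \<le> d $ l" for l
    using le by (simp add: less_eq_vec_def)
  have "\<exists>g. dominates g \<Phi> \<and> tight_at g \<Phi> (overlay Q d c) \<and> infinite_beyond g (overlay Q d c)
      \<and> (\<forall>l t. t \<le> c $ l \<longrightarrow> g l t = f l t)" for Q
  proof -
    have "finite Q" by simp
    then show ?thesis
    proof (induction Q)
      case empty
      then show ?case using f by auto
    next
      case (insert i Q)
      from insert.IH obtain g where g: "dominates g \<Phi>" "tight_at g \<Phi> (overlay Q d c)"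
        "infinite_beyond g (overlay Q d c)" "\<And>l t. t \<le> c $ l \<Longrightarrow> g l t = f l t"
        by auto
      have q: "overlay Q d c \<in> nonneg_cone"
        using c le' by (simp add: nonneg_cone_def) (meson order_trans)
      obtain k where k: "dominates k \<Phi>" "tight_at k \<Phi> (put i (d $ i) (overlay Q d c))"
        "infinite_beyond k (put i (d $ i) (overlay Q d c))"
        "\<And>l t. t \<le> overlay Q d c $ l \<Longrightarrow> k l t = g l t"
        by (rule dominates_extend_coordinate[OF \<Phi> q _ g(1,2,3)]) (use le' in auto)
      have "k l t = f l t" if "t \<le> c $ l" for l t
        using k(4)[of t l] g(4)[of t l] that le'[of l] by (auto split: if_splits)
      with k show ?case
        by (auto simp: overlay_insert)
    qed
  qed
  from this[of UNIV] that show thesis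
    by (auto simp: overlay_def)
qed

text \<open>
  The induction removes the largest element of the chain. It starts at the origin, where
  the majorant that is infinite off the origin is tight.
\<close>

lemma finite_chain_certificate:
  assumes \<Phi>: "supermodular \<Phi>" "\<And>i t. \<Phi> (axis i t) = 0"
    and K: "finite K" "K \<subseteq> nonneg_cone" "\<And>a b. a \<in> K \<Longrightarrow> b \<in> K \<Longrightarrow> a \<le> b \<or> b \<le> a"
  shows "\<exists>f c. dominates f \<Phi> \<and> tight_at f \<Phi> c \<and> infinite_beyond f c \<and> c \<in> insert 0 K
    \<and> (\<forall>a\<in>K. a \<le> c \<and> tight_at f \<Phi> a)"
  using K
proof (induction "card K" arbitrary: K)
  case 0
  define f :: "'a \<Rightarrow> real \<Rightarrow> ennreal" where "f i t = (if t \<le> 0 then 0 else \<infinity>)" for i t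
  have 00: "\<Phi> 0 = 0"
    using \<Phi>(2)[of undefined 0] by (simp add: axis_eq_0_iff[THEN iffD2])
  have "ennreal (\<Phi> y) \<le> (\<Sum>i\<in>UNIV. f i (y $ i))" if y: "y \<in> nonneg_cone" for y
  proof (cases "y = 0")
    case False
    then obtain l where "y $ l > 0"
      using cone_nth[OF y] by (metis less_eq_real_def vec_eq_iff zero_index)
    then have "(\<Sum>i\<in>UNIV. f i (y $ i)) = \<infinity>"
      by (subst sum.remove[of UNIV l]) (auto simp: f_def)
    then show ?thesis by (simp only: infinity_ennreal_def top_greatest)
  qed (simp add: 00)
  then have "dominates f \<Phi>"
    by (auto simp: dominates_def f_def mono_def)
  moreover have "tight_at f \<Phi> 0" "infinite_beyond f 0"
    by (auto simp: tight_at_def f_def infinite_beyond_def)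
  ultimately show ?case
    using 0 by auto
next
  case (Suc n)
  then obtain m where m: "m \<in> K" "\<And>a. a \<in> K \<Longrightarrow> m \<le> a \<Longrightarrow> a = m"
    using finite_has_maximal[of K] by (metis card_eq_0_iff nat.distinct(1))
  then have max: "a \<le> m" if "a \<in> K" for a
    using Suc.prems(3)[OF that m(1)] that by auto
  have "\<exists>f c. dominates f \<Phi> \<and> tight_at f \<Phi> c \<and> infinite_beyond f c \<and> c \<in> insert 0 (K - {m})
    \<and> (\<forall>a\<in>K - {m}. a \<le> c \<and> tight_at f \<Phi> a)"
    using Suc m by (intro Suc.hyps(1)) auto
  then obtain f c where f: "dominates f \<Phi>" "tight_at f \<Phi> c" "infinite_beyond f c"
    and c: "c \<in> insert 0 (K - {m})" and t: "\<And>a. a \<in> K - {m} \<Longrightarrow> a \<le> c \<and> tight_at f \<Phi> a"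
    by blast
  have "m \<in> nonneg_cone"
    using Suc.prems(2) m(1) by blast
  then have c': "c \<in> nonneg_cone" "c \<le> m"
    using c Suc.prems(2) max by (auto simp: less_eq_vec_def cone_nth)
  obtain g where g: "dominates g \<Phi>" "tight_at g \<Phi> m" "infinite_beyond g m"
    "\<And>l t. t \<le> c $ l \<Longrightarrow> g l t = f l t"
    using dominates_extend[OF \<Phi> c' f] by blast
  have "tight_at g \<Phi> a" if "a \<in> K" for a
  proof (cases "a = m")
    case False
    then have "a \<le> c" "tight_at f \<Phi> a" using t that by auto
    then show ?thesis
      using g(4) by (simp add: tight_at_def less_eq_vec_def)
  qed (simp add: g)
  then show ?case
    using g max m(1) by blast
qed

lemma compact_UNIV_fun:
  assumes "compact (UNIV :: 'b::topological_space set)"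
  shows "compact (UNIV :: ('a \<Rightarrow> 'b) set)"
proof -
  have "compact_space (product_topology (\<lambda>_::'a. euclidean :: 'b topology) UNIV)"
    unfolding compact_space_product_topology using assms by (simp add: compact_space_def)
  then show ?thesis
    by (simp add: euclidean_product_topology compact_space_def)
qed

text \<open>
  Being a majorant and being tight at a given point are closed conditions for pointwise
  convergence, because each involves only finitely many values at a time. For finitely many points
  they can be met together, so the finite intersection property applies.
\<close>

theorem chain_certificate:
  fixes \<Phi> :: "real ^ 'm \<Rightarrow> real"
  assumes \<Phi>: "supermodular \<Phi>" "\<And>i t. \<Phi> (axis i t) = 0"
    and C: "C \<subseteq> nonneg_cone" "\<And>a b. a \<in> C \<Longrightarrow> b \<in> C \<Longrightarrow> a \<le> b \<or> b \<le> a"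
  obtains f where "dominates f \<Phi>" "\<And>a. a \<in> C \<Longrightarrow> tight_at f \<Phi> a"
proof -
  have cont: "continuous_on UNIV (\<lambda>f :: 'm \<Rightarrow> real \<Rightarrow> ennreal. f i t)" for i t
    by (rule continuous_on_product_then_coordinatewise)
       (rule continuous_on_product_then_coordinatewise, rule continuous_on_id)
  have closed_dom: "closed {f. dominates f \<Phi>}"
    unfolding dominates_def mono_def Ball_def
    by (intro closed_Collect_conj closed_Collect_all closed_Collect_imp closed_Collect_le
        closed_Collect_eq continuous_on_sum cont continuous_on_const open_Collect_const)
  have closed_tight: "closed {f. tight_at f \<Phi> a}" for a
    unfolding tight_at_def
    by (intro closed_Collect_le continuous_on_sum cont continuous_on_const)
  have "{f. dominates f \<Phi>} \<inter> (\<Inter>a\<in>C. {f. tight_at f \<Phi> a}) \<noteq> {}"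
  proof (rule compact_imp_fip_image)
    have "compact (UNIV :: ('m \<Rightarrow> real \<Rightarrow> ennreal) set)"
      by (intro compact_UNIV_fun compact_UNIV)
    then show "compact {f. dominates f \<Phi>}"
      using closed_Int_compact[OF closed_dom] by fastforce
    show "{f. dominates f \<Phi>} \<inter> (\<Inter>a\<in>K. {f. tight_at f \<Phi> a}) \<noteq> {}"
      if "finite K" "K \<subseteq> C" for K
      using finite_chain_certificate[OF \<Phi> that(1)] that C by blast
  qed (rule closed_tight)
  with that show thesis by blast
qed

lemma borel_measurable_mono_ennreal:
  fixes f :: "real \<Rightarrow> ennreal"
  assumes "mono f"
  shows "f \<in> borel_measurable borel"
proof (rule borel_measurableI_less)
  fix a
  have "is_interval {x. f x < a}"
    using assms unfolding is_interval_1 by (auto dest: monoD intro: order_le_less_trans)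
  then show "{x \<in> space borel. f x < a} \<in> sets borel"
    by (simp add: real_interval_borel_measurable)
qed

section \<open>Comonotone couplings\<close>

text \<open>
  Superlevel sets at positive heights determine the two distributions on \<open>{e<..}\<close> for every
  \<open>e > 0\<close>, where they are finite measures. The sets where the functions vanish may have different
  volumes, hence \<open>f 0 = 0\<close>.
\<close>

lemma nn_integral_equimeasurable:
  fixes u v :: "'a \<Rightarrow> real" and f :: "real \<Rightarrow> ennreal"
  assumes [measurable]: "u \<in> borel_measurable M" "v \<in> borel_measurable M" "f \<in> borel_measurable borel"
    and nonneg: "\<And>x. x \<in> space M \<Longrightarrow> 0 \<le> u x" "\<And>x. x \<in> space M \<Longrightarrow> 0 \<le> v x"
    and eq: "\<And>t. 0 < t \<Longrightarrow> emeasure M {x \<in> space M. u x > t} = emeasure M {x \<in> space M. v x > t}"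
    and fin: "\<And>t. 0 < t \<Longrightarrow> emeasure M {x \<in> space M. u x > t} < \<infinity>"
    and f0: "f 0 = 0"
  shows "(\<integral>\<^sup>+x. f (u x) \<partial>M) = (\<integral>\<^sup>+x. f (v x) \<partial>M)"
proof -
  define e :: "nat \<Rightarrow> real" where "e n = inverse (real (Suc n))" for n
  define D where "D w n = density (distr M borel w) (indicator {e n<..})" for w :: "'a \<Rightarrow> real" and n
  have e_pos: "0 < e n" for n by (simp add: e_def)
  have D_emeasure: "emeasure (D w n) {t<..} = emeasure M {x \<in> space M. w x > max (e n) t}"
    if [measurable]: "w \<in> borel_measurable M" for w n t
  proof -
    have "emeasure (D w n) {t<..} = emeasure (distr M borel w) ({e n<..} \<inter> {t<..})"
      unfolding D_def by (subst emeasure_density) (auto simp: indicator_inter_arith[symmetric])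
    also have "\<dots> = emeasure M {x \<in> space M. w x > max (e n) t}"
      by (subst emeasure_distr) (auto intro!: arg_cong[where f = "emeasure M"])
    finally show ?thesis .
  qed
  have D_eq: "D u n = D v n" for n
  proof (rule measure_eqI_generator_eq)
    show "Int_stable (range (greaterThan :: real \<Rightarrow> real set))"
    proof -
      have "{a<..} \<inter> {b<..} = {max a b<..}" for a b :: real by auto
      then show ?thesis by (auto simp: Int_stable_def)
    qed
    show "emeasure (D u n) A = emeasure (D v n) A" if "A \<in> range greaterThan" for A
      using that eq e_pos by (auto simp: D_emeasure less_max_iff_disj simp del: max_less_iff_conj)
    show "sets (D u n) = sigma_sets UNIV (range greaterThan)"
      "sets (D v n) = sigma_sets UNIV (range greaterThan)"
      unfolding D_def by (simp_all add: borel_Ioi)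
    show "(\<Union>k::nat. {- real k<..}) = UNIV"
    proof -
      have "\<exists>k::nat. - real k < x" for x :: real
        using reals_Archimedean2[of "- x"] by (auto simp: minus_less_iff)
      then show ?thesis by auto
    qed
    show "emeasure (D u n) {- real k<..} \<noteq> \<infinity>" for k :: nat
      using fin[of "max (e n) (- real k)"] e_pos[of n]
      by (simp add: D_emeasure less_max_iff_disj del: max_less_iff_conj)
  qed auto
  have int: "(\<integral>\<^sup>+x. f (w x) \<partial>M) = (SUP n. \<integral>\<^sup>+t. f t \<partial>D w n)"
    if [measurable]: "w \<in> borel_measurable M" and w: "\<And>x. x \<in> space M \<Longrightarrow> 0 \<le> w x" for w
  proof -
    have "(\<integral>\<^sup>+t. f t \<partial>D w n) = (\<integral>\<^sup>+x. indicator {e n<..} (w x) * f (w x) \<partial>M)" for n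
      unfolding D_def by (subst nn_integral_density) (auto simp: nn_integral_distr)
    moreover have "(\<integral>\<^sup>+x. f (w x) \<partial>M) = (\<integral>\<^sup>+x. (SUP n. indicator {e n<..} (w x) * f (w x)) \<partial>M)"
    proof (intro nn_integral_cong)
      fix x assume x: "x \<in> space M"
      show "f (w x) = (SUP n. indicator {e n<..} (w x) * f (w x))"
      proof (cases "w x = 0")
        case True
        then show ?thesis by (simp add: f0)
      next
        case False
        then obtain n where n: "e n < w x"
          using w[OF x] reals_Archimedean[of "w x"] by (auto simp: e_def)
        show ?thesis
        proof (rule antisym)
          show "f (w x) \<le> (SUP n. indicator {e n<..} (w x) * f (w x))"
            using n by (intro SUP_upper2[of n]) auto
          show "(SUP n. indicator {e n<..} (w x) * f (w x)) \<le> f (w x)"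
            by (intro SUP_least) (auto simp: indicator_def)
        qed
      qed
    qed
    moreover have "\<dots> = (SUP n. \<integral>\<^sup>+x. indicator {e n<..} (w x) * f (w x) \<partial>M)"
    proof (intro nn_integral_monotone_convergence_SUP)
      have "e (Suc n) \<le> e n" for n
        by (simp add: e_def le_imp_inverse_le)
      then show "incseq (\<lambda>n x. indicator {e n<..} (w x) * f (w x))"
        by (intro incseq_SucI le_funI mult_right_mono)
           (auto simp: indicator_def intro: order_le_less_trans)
    qed auto
    ultimately show ?thesis by simp
  qed
  show ?thesis
    by (subst (1 2) int) (auto simp: nonneg D_eq)
qed

lemma borel_measurable_vec_lambda:
  assumes "\<And>i. (\<lambda>x. g i x) \<in> borel_measurable M"
  shows "(\<lambda>x. (\<chi> i. g i x) :: real ^ 'm) \<in> borel_measurable M"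
  by (rule borel_measurable_euclidean_space[THEN iffD2])
     (use assms in \<open>auto simp: Basis_vec_def inner_axis\<close>)

lemma borel_measurable_on_cone:
  assumes F: "F \<in> borel_measurable (restrict_space borel nonneg_cone)"
    and g: "\<And>i. g i \<in> borel_measurable M" "\<And>i x. x \<in> space M \<Longrightarrow> 0 \<le> g i x"
  shows "(\<lambda>x. F (\<chi> i. g i x)) \<in> borel_measurable M"
  by (rule measurable_compose[OF _ F])
     (use g borel_measurable_vec_lambda[of g M] in
       \<open>auto simp: nonneg_cone_def intro!: measurable_restrict_space2\<close>)

text \<open>
  The functions \<open>v i\<close> play the role of the rearrangements of \<open>u i\<close>: each is equimeasurable with
  \<open>u i\<close>, and off a null set their joint values form a chain.
\<close>

locale comonotone_coupling =
  fixes M :: "'a measure" and u v :: "'m::finite \<Rightarrow> 'a \<Rightarrow> real" and A :: "'a set"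
  assumes measurable_u [measurable]: "\<And>i. u i \<in> borel_measurable M"
    and measurable_v [measurable]: "\<And>i. v i \<in> borel_measurable M"
    and u_nonneg: "\<And>i x. x \<in> space M \<Longrightarrow> 0 \<le> u i x"
    and v_nonneg: "\<And>i x. x \<in> space M \<Longrightarrow> 0 \<le> v i x"
    and superlevel_eq: "\<And>i t. 0 < t \<Longrightarrow>
      emeasure M {x \<in> space M. u i x > t} = emeasure M {x \<in> space M. v i x > t}"
    and superlevel_finite: "\<And>i t. 0 < t \<Longrightarrow> emeasure M {x \<in> space M. u i x > t} < \<infinity>"
    and A: "A \<subseteq> space M" "AE x in M. x \<in> A"
    and comonotone: "\<And>x x'. x \<in> A \<Longrightarrow> x' \<in> A \<Longrightarrow>
      (\<forall>i. v i x \<le> v i x') \<or> (\<forall>i. v i x' \<le> v i x)"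
begin

abbreviation U where "U x \<equiv> (\<chi> i. u i x)"
abbreviation W where "W x \<equiv> (\<chi> i. v i x)"

lemma U_in_cone: "x \<in> space M \<Longrightarrow> U x \<in> nonneg_cone"
  by (simp add: nonneg_cone_def u_nonneg)

lemma W_in_cone: "x \<in> space M \<Longrightarrow> W x \<in> nonneg_cone"
  by (simp add: nonneg_cone_def v_nonneg)

lemma nn_integral_coordinate:
  "f \<in> borel_measurable borel \<Longrightarrow> f 0 = 0 \<Longrightarrow> (\<integral>\<^sup>+x. f (u i x) \<partial>M) = (\<integral>\<^sup>+x. f (v i x) \<partial>M)"
  by (rule nn_integral_equimeasurable[OF measurable_u measurable_v _ u_nonneg v_nonneg
        superlevel_eq superlevel_finite])

lemma separable_bound:
  assumes \<Phi>: "supermodular \<Phi>" "\<And>i t. \<Phi> (axis i t) = 0"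
  obtains f where "dominates f \<Phi>"
    "(\<integral>\<^sup>+x. (\<Sum>i\<in>UNIV. f i (u i x)) \<partial>M) \<le> (\<integral>\<^sup>+x. ennreal (\<Phi> (W x)) \<partial>M)"
proof -
  obtain f where f: "dominates f \<Phi>" "\<And>a. a \<in> W ` A \<Longrightarrow> tight_at f \<Phi> a"
  proof (rule chain_certificate[OF \<Phi>])
    show "W ` A \<subseteq> nonneg_cone"
      using A(1) W_in_cone by blast
    show "a \<le> b \<or> b \<le> a" if "a \<in> W ` A" "b \<in> W ` A" for a b
      using that comonotone by (fastforce simp: less_eq_vec_def)
  qed blast
  have [measurable]: "f i \<in> borel_measurable borel" for i
    using f(1) by (intro borel_measurable_mono_ennreal) (simp add: dominates_def)
  have f0: "f i 0 = 0" for i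
    using f(1) by (simp add: dominates_def)
  have "(\<integral>\<^sup>+x. (\<Sum>i\<in>UNIV. f i (u i x)) \<partial>M) = (\<Sum>i\<in>UNIV. \<integral>\<^sup>+x. f i (u i x) \<partial>M)"
    by (rule nn_integral_sum) measurable
  also have "\<dots> = (\<Sum>i\<in>UNIV. \<integral>\<^sup>+x. f i (v i x) \<partial>M)"
    by (intro sum.cong refl nn_integral_coordinate f0) measurable
  also have "\<dots> = (\<integral>\<^sup>+x. (\<Sum>i\<in>UNIV. f i (v i x)) \<partial>M)"
    by (rule nn_integral_sum[symmetric]) measurable
  also have "\<dots> \<le> (\<integral>\<^sup>+x. ennreal (\<Phi> (W x)) \<partial>M)"
  proof (rule nn_integral_mono_AE)
    show "AE x in M. (\<Sum>i\<in>UNIV. f i (v i x)) \<le> ennreal (\<Phi> (W x))"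
      using A(2)
    proof eventually_elim
      case (elim x)
      from f(2)[OF imageI[OF this]] show ?case by (simp add: tight_at_def)
    qed
  qed
  finally show thesis
    using that f(1) by blast
qed

lemma separable_dominates:
  assumes "dominates f \<Phi>" "x \<in> space M"
  shows "ennreal (\<Phi> (U x)) \<le> (\<Sum>i\<in>UNIV. f i (u i x))"
  using assms U_in_cone[OF assms(2)] unfolding dominates_def by fastforce

lemma nn_integral_le:
  assumes \<Phi>: "supermodular \<Phi>" "\<And>i t. \<Phi> (axis i t) = 0"
  shows "(\<integral>\<^sup>+x. ennreal (\<Phi> (U x)) \<partial>M) \<le> (\<integral>\<^sup>+x. ennreal (\<Phi> (W x)) \<partial>M)"
proof -
  obtain f where f: "dominates f \<Phi>"
    "(\<integral>\<^sup>+x. (\<Sum>i\<in>UNIV. f i (u i x)) \<partial>M) \<le> (\<integral>\<^sup>+x. ennreal (\<Phi> (W x)) \<partial>M)"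
    using separable_bound[OF \<Phi>] .
  have "(\<integral>\<^sup>+x. ennreal (\<Phi> (U x)) \<partial>M) \<le> (\<integral>\<^sup>+x. (\<Sum>i\<in>UNIV. f i (u i x)) \<partial>M)"
    by (intro nn_integral_mono separable_dominates f)
  with f(2) show ?thesis by (rule order_trans[rotated])
qed

text \<open>
  At two points of contact, the separable majorant bounds \<open>\<Phi> (sup a b) + \<Phi> (inf a b)\<close> by
  \<open>\<Phi> a + \<Phi> b\<close>, because in each coordinate \<open>sup a b\<close> and \<open>inf a b\<close> take the same two values as
  \<open>a\<close> and \<open>b\<close>. This contradicts strict supermodularity unless the points are ordered in
  the directions \<open>i\<close> and \<open>j\<close>.
\<close>

lemma separable_contact_ordered:
  assumes \<Phi>: "supermodular \<Phi>" "\<And>i t. \<Phi> (axis i t) = 0" "strictly_supermodular_in \<Phi> i j"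
    and f: "dominates f \<Phi>"
    and a: "a \<in> nonneg_cone" "(\<Sum>l\<in>UNIV. f l (a $ l)) = ennreal (\<Phi> a)"
    and b: "b \<in> nonneg_cone" "(\<Sum>l\<in>UNIV. f l (b $ l)) = ennreal (\<Phi> b)"
    and ij: "b $ i < a $ i"
  shows "b $ j \<le> a $ j"
proof (rule ccontr)
  assume "\<not> b $ j \<le> a $ j"
  then have "\<Phi> a + \<Phi> b < \<Phi> (sup a b) + \<Phi> (inf a b)"
    by (intro strictly_supermodular_inf_sup[OF \<Phi>(1,3) a(1) b(1) ij]) simp
  moreover have "ennreal (\<Phi> (sup a b) + \<Phi> (inf a b)) \<le> ennreal (\<Phi> a + \<Phi> b)"
  proof -
    note pos = nonneg_of_zero_on_axes[OF \<Phi>(1,2)]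
    have "ennreal (\<Phi> (sup a b) + \<Phi> (inf a b)) = ennreal (\<Phi> (sup a b)) + ennreal (\<Phi> (inf a b))"
      using a b by (intro ennreal_plus pos sup_in_cone inf_in_cone)
    also have "\<dots> \<le> (\<Sum>l\<in>UNIV. f l (sup a b $ l)) + (\<Sum>l\<in>UNIV. f l (inf a b $ l))"
      using f sup_in_cone[OF a(1) b(1)] inf_in_cone[OF a(1) b(1)]
      unfolding dominates_def by (intro add_mono) blast+
    also have "\<dots> = (\<Sum>l\<in>UNIV. f l (a $ l)) + (\<Sum>l\<in>UNIV. f l (b $ l))"
      unfolding sum.distrib[symmetric] by (intro sum.cong) (auto simp: inf_vec_nth sup_vec_nth max_def min_def ac_simps)
    also have "\<dots> = ennreal (\<Phi> a + \<Phi> b)"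
      using a b pos by simp
    finally show ?thesis .
  qed
  moreover have "0 \<le> \<Phi> a + \<Phi> b"
    using a(1) b(1) nonneg_of_zero_on_axes[OF \<Phi>(1,2)] by (intro add_nonneg_nonneg) auto
  ultimately show False
    by (simp add: ennreal_le_iff del: ennreal_plus)
qed

text \<open>
  The integral of the majorant lies between the integrals of \<open>\<Phi>(u)\<close> and \<open>\<Phi>(v)\<close>. When these are equal
  and finite, \<open>u\<close> is almost everywhere in contact with the majorant.
\<close>

lemma equality_imp_ordered:
  assumes \<Phi>: "supermodular \<Phi>" "\<And>i t. \<Phi> (axis i t) = 0" "strictly_supermodular_in \<Phi> i j"
    and meas: "(\<lambda>x. \<Phi> (U x)) \<in> borel_measurable M"
    and eq: "(\<integral>\<^sup>+x. ennreal (\<Phi> (U x)) \<partial>M) = (\<integral>\<^sup>+x. ennreal (\<Phi> (W x)) \<partial>M)"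
    and fin: "(\<integral>\<^sup>+x. ennreal (\<Phi> (W x)) \<partial>M) < \<infinity>"
  obtains E where "AE x in M. x \<in> E"
    "\<And>x x'. x \<in> E \<Longrightarrow> x' \<in> E \<Longrightarrow> (u i x - u i x') * (u j x - u j x') \<ge> 0"
proof -
  obtain f where f: "dominates f \<Phi>"
    "(\<integral>\<^sup>+x. (\<Sum>i\<in>UNIV. f i (u i x)) \<partial>M) \<le> (\<integral>\<^sup>+x. ennreal (\<Phi> (W x)) \<partial>M)"
    using separable_bound[OF \<Phi>(1,2)] .
  have [measurable]: "f i \<in> borel_measurable borel" for i
    using f(1) by (intro borel_measurable_mono_ennreal) (simp add: dominates_def)
  define S where "S x = (\<Sum>i\<in>UNIV. f i (u i x))" for x
  have [measurable]: "S \<in> borel_measurable M"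
    unfolding S_def by measurable
  have le: "ennreal (\<Phi> (U x)) \<le> S x" if "x \<in> space M" for x
    unfolding S_def using separable_dominates[OF f(1) that] .
  have "(\<integral>\<^sup>+x. ennreal (\<Phi> (U x)) \<partial>M) = (\<integral>\<^sup>+x. S x \<partial>M)"
  proof (rule antisym)
    show "(\<integral>\<^sup>+x. ennreal (\<Phi> (U x)) \<partial>M) \<le> (\<integral>\<^sup>+x. S x \<partial>M)"
      by (intro nn_integral_mono le)
    show "(\<integral>\<^sup>+x. S x \<partial>M) \<le> (\<integral>\<^sup>+x. ennreal (\<Phi> (U x)) \<partial>M)"
      using f(2) by (simp only: S_def eq)
  qed
  then have *: "AE x in M. S x \<le> ennreal (\<Phi> (U x))"
    using fin eq meas le nn_integral_less[of "\<lambda>x. ennreal (\<Phi> (U x))" M S] by fastforce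
  define E where "E = {x \<in> space M. S x = ennreal (\<Phi> (U x))}"
  have "AE x in M. x \<in> E"
    using * AE_space by eventually_elim (auto simp: E_def intro: antisym le)
  moreover have "(u i x - u i x') * (u j x - u j x') \<ge> 0" if "x \<in> E" "x' \<in> E" for x x'
  proof -
    have *: "u j y \<le> u j z" if "u i y < u i z" "y \<in> E" "z \<in> E" for y z
      using separable_contact_ordered[OF \<Phi> f(1), of "U z" "U y"] that
      by (auto simp: E_def S_def U_in_cone)
    show ?thesis
      using *[of x x'] *[of x' x] that
      by (cases "u i x" "u i x'" rule: linorder_cases) (auto intro: mult_nonpos_nonpos)
  qed
  ultimately show thesis using that by blast
qed

end

section \<open>Rearrangement in a space with radial symmetry\<close>

lemma borel_measurable_antimono_ennreal:
  fixes f :: "real \<Rightarrow> ennreal"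
  assumes "antimono f"
  shows "f \<in> borel_measurable borel"
proof (rule borel_measurableI_less)
  fix a
  have "is_interval {x. f x < a}"
    using assms unfolding is_interval_1 by (auto dest: antimonoD intro: order_le_less_trans)
  then show "{x \<in> space borel. f x < a} \<in> sets borel"
    by (simp add: real_interval_borel_measurable)
qed

lemma AE_subset_of_emeasure_le:
  assumes [measurable]: "A \<in> sets M" "B \<in> sets M"
    and sub: "AE x in M. x \<in> A \<longrightarrow> x \<in> B"
    and le: "emeasure M B \<le> emeasure M A" and fin: "emeasure M A < \<infinity>"
  shows "AE x in M. x \<in> B \<longrightarrow> x \<in> A"
proof -
  have "emeasure M (B \<inter> A) = emeasure M A"
    using sub by (intro emeasure_eq_AE) auto
  moreover have "emeasure M B = emeasure M (B \<inter> A) + emeasure M (B - A)"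
    by (subst plus_emeasure) (auto intro!: arg_cong[where f = "emeasure M"])
  ultimately have "emeasure M A + emeasure M (B - A) \<le> emeasure M A + 0"
    using le by simp
  then have "emeasure M (B - A) = 0"
    using fin by (subst (asm) ennreal_add_left_cancel_le) auto
  then have "B - A \<in> null_sets M" by auto
  from AE_not_in[OF this] show ?thesis by eventually_elim auto
qed

lemma (in sigma_finite_measure) AE_pair_both:
  assumes "AE x in M. x \<in> E"
  shows "AE z in M \<Otimes>\<^sub>M M. fst z \<in> E \<and> snd z \<in> E"
proof -
  obtain N where N: "N \<in> null_sets M" "{x \<in> space M. x \<notin> E} \<subseteq> N"
    using assms by (auto elim!: AE_E intro: null_setsI)
  have [measurable]: "N \<in> sets M" using N by auto
  have "N \<times> space M \<in> null_sets (M \<Otimes>\<^sub>M M)" "space M \<times> N \<in> null_sets (M \<Otimes>\<^sub>M M)"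
    using N(1) by (auto simp: null_sets_def emeasure_pair_measure_Times)
  then have "(N \<times> space M) \<union> (space M \<times> N) \<in> null_sets (M \<Otimes>\<^sub>M M)"
    by (rule null_sets.Un)
  from AE_not_in[OF this] AE_space show ?thesis
    by eventually_elim (use N(2) in \<open>auto simp: space_pair_measure\<close>)
qed

lemma emeasure_greater_SUP:
  fixes f :: "'a \<Rightarrow> real"
  assumes [measurable]: "f \<in> borel_measurable M"
  shows "emeasure M {x \<in> space M. s < f x}
    = (SUP n. emeasure M {x \<in> space M. s + inverse (real (Suc n)) < f x})"
proof -
  have "{x \<in> space M. s < f x} = (\<Union>n. {x \<in> space M. s + inverse (real (Suc n)) < f x})"
  proof (intro set_eqI iffI)
    fix x assume x: "x \<in> {x \<in> space M. s < f x}"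
    then obtain n where "inverse (real (Suc n)) < f x - s"
      using reals_Archimedean[of "f x - s"] by auto
    then have "s + inverse (real (Suc n)) < f x" by linarith
    with x show "x \<in> (\<Union>n. {x \<in> space M. s + inverse (real (Suc n)) < f x})"
      by blast
  next
    fix x assume "x \<in> (\<Union>n. {x \<in> space M. s + inverse (real (Suc n)) < f x})"
    then obtain n where x: "x \<in> space M" "s + inverse (real (Suc n)) < f x" by blast
    moreover have "0 < inverse (real (Suc n))" by simp
    ultimately have "s < f x" by linarith
    with x show "x \<in> {x \<in> space M. s < f x}" by simp
  qed
  moreover have "incseq (\<lambda>n. {x \<in> space M. s + inverse (real (Suc n)) < f x})"
  proof (rule incseq_SucI, rule subsetI)
    fix n x assume "x \<in> {x \<in> space M. s + inverse (real (Suc n)) < f x}"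
    moreover have "inverse (real (Suc (Suc n))) \<le> inverse (real (Suc n))"
      by (rule le_imp_inverse_le) auto
    ultimately show "x \<in> {x \<in> space M. s + inverse (real (Suc (Suc n))) < f x}"
      by (smt (verit) mem_Collect_eq)
  qed
  ultimately show ?thesis
    by (subst SUP_emeasure_incseq) auto
qed

lemma emeasure_le_INF:
  fixes f :: "'a \<Rightarrow> real"
  assumes [measurable]: "f \<in> borel_measurable M"
    and fin: "\<And>r. emeasure M {x \<in> space M. f x < r} < \<infinity>"
  shows "emeasure M {x \<in> space M. f x \<le> s}
    = (INF n. emeasure M {x \<in> space M. f x < s + inverse (real (Suc n))})"
proof -
  have "{x \<in> space M. f x \<le> s} = (\<Inter>n. {x \<in> space M. f x < s + inverse (real (Suc n))})"
  proof (intro set_eqI iffI)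
    fix x assume x: "x \<in> {x \<in> space M. f x \<le> s}"
    have "f x < s + inverse (real (Suc n))" for n
    proof -
      have "0 < inverse (real (Suc n))" by simp
      with x show ?thesis by (smt (verit) mem_Collect_eq)
    qed
    with x show "x \<in> (\<Inter>n. {x \<in> space M. f x < s + inverse (real (Suc n))})"
      by blast
  next
    fix x assume x: "x \<in> (\<Inter>n. {x \<in> space M. f x < s + inverse (real (Suc n))})"
    have "f x \<le> s"
    proof (rule ccontr)
      assume "\<not> f x \<le> s"
      then obtain n where n: "inverse (real (Suc n)) < f x - s"
        using reals_Archimedean[of "f x - s"] by auto
      from x have "f x < s + inverse (real (Suc n))" by blast
      with n show False by linarith
    qed
    with x show "x \<in> {x \<in> space M. f x \<le> s}" by blast
  qed
  moreover have "decseq (\<lambda>n. {x \<in> space M. f x < s + inverse (real (Suc n))})"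
  proof (rule decseq_SucI, rule subsetI)
    fix n x assume "x \<in> {x \<in> space M. f x < s + inverse (real (Suc (Suc n)))}"
    moreover have "inverse (real (Suc (Suc n))) \<le> inverse (real (Suc n))"
      by (rule le_imp_inverse_le) auto
    ultimately show "x \<in> {x \<in> space M. f x < s + inverse (real (Suc n))}"
      by (smt (verit) mem_Collect_eq)
  qed
  ultimately show ?thesis
    using fin by (subst INF_emeasure_decseq) (auto simp: less_top)
qed

text \<open>
  The properties of the distance to the base point on which rearrangement depends: finite balls
  and null spheres make the volume of a ball a continuous function of its radius.
\<close>

locale radial_space =
  fixes X :: "'a pointed_space"
  assumes radius_measurable: "(\<lambda>x. distance X x (basepoint X)) \<in> borel_measurable (volume X)"
    and radius_nonneg: "x \<in> points X \<Longrightarrow> 0 \<le> distance X x (basepoint X)"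
    and finite_ball: "emeasure (volume X) (base_ball X r) < \<infinity>"
    and null_sphere: "emeasure (volume X) {x \<in> points X. distance X x (basepoint X) = r} = 0"
begin

abbreviation M where "M \<equiv> volume X"

definition radius :: "'a \<Rightarrow> real" where
  "radius x = distance X x (basepoint X)"

definition ball_volume :: "real \<Rightarrow> ennreal" where
  "ball_volume r = emeasure M (base_ball X r)"

definition enclosed :: "'a \<Rightarrow> ennreal" where
  "enclosed x = ball_volume (radius x)"

lemma measurable_radius [measurable]: "radius \<in> borel_measurable M"
  using radius_measurable by (simp add: radius_def[abs_def])

lemma base_ball_eq: "base_ball X r = {x \<in> space M. radius x < r}"
  by (simp add: base_ball_def radius_def)

lemma sets_base_ball [measurable]: "base_ball X r \<in> sets M"
  unfolding base_ball_eq by measurable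

lemma mono_ball_volume: "mono ball_volume"
  by (intro monoI) (auto simp: ball_volume_def base_ball_eq intro!: emeasure_mono)

lemma measurable_enclosed [measurable]: "enclosed \<in> borel_measurable M"
  unfolding enclosed_def[abs_def]
  using borel_measurable_mono_ennreal[OF mono_ball_volume] by measurable

lemma sigma_finite: "sigma_finite_measure M"
proof
  show "\<exists>A. countable A \<and> A \<subseteq> sets M \<and> \<Union>A = space M \<and> (\<forall>a\<in>A. emeasure M a \<noteq> \<infinity>)"
  proof (intro exI[of _ "range (\<lambda>n::nat. base_ball X (real n))"] conjI)
    show "\<Union> (range (\<lambda>n::nat. base_ball X (real n))) = space M"
      using reals_Archimedean2 by (auto simp: base_ball_eq)
    show "\<forall>a\<in>range (\<lambda>n::nat. base_ball X (real n)). emeasure M a \<noteq> \<infinity>"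
      using finite_ball by (auto simp: less_top)
  qed auto
qed

text \<open>
  An intermediate value argument for the volume of balls: it is continuous from the left by
  continuity of measures, and from the right because balls are finite and spheres are null.
\<close>

lemma ball_volume_attains:
  assumes c: "c < emeasure M (space M)"
  obtains r where "ball_volume r = c"
proof -
  let ?e = "\<lambda>n. inverse (real (Suc n))"
  \<comment> \<open>The radius sought is the supremum of those that enclose at most \<open>c\<close>.\<close>
  define S where "S = {r. ball_volume r \<le> c}"
  have "base_ball X 0 = {}"
    using radius_nonneg by (force simp: base_ball_def)
  then have "0 \<in> S" by (simp add: S_def ball_volume_def)
  have "(SUP n::nat. emeasure M (base_ball X (real n))) = emeasure M (\<Union>n::nat. base_ball X (real n))"
    by (intro SUP_emeasure_incseq incseq_SucI) (auto simp: base_ball_eq)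
  also have "(\<Union>n::nat. base_ball X (real n)) = space M"
    using reals_Archimedean2 by (auto simp: base_ball_eq)
  finally have "c < (SUP n::nat. ball_volume (real n))"
    using c by (simp add: ball_volume_def)
  then obtain n :: nat where n: "c < ball_volume (real n)"
    by (auto simp: less_SUP_iff)
  have bdd: "r \<le> real n" if "r \<in> S" for r
    using that n monoD[OF mono_ball_volume, of "real n" r]
    by (force simp: S_def)
  then have "bdd_above S" by (auto simp: bdd_above_def)
  define s where "s = Sup S"
  have "ball_volume s \<le> c"
  proof -
    have "ball_volume s = (SUP n. ball_volume (s - ?e n))"
      using emeasure_greater_SUP[of "\<lambda>x. - radius x" M "- s"]
      by (simp add: ball_volume_def base_ball_eq algebra_simps neg_less_iff_less less_diff_eq)
    also have "\<dots> \<le> c"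
    proof (rule SUP_least)
      fix n
      have "s - ?e n < Sup S" by (simp add: s_def del: of_nat_Suc)
      then obtain r where "r \<in> S" "s - ?e n < r"
        using \<open>0 \<in> S\<close> less_cSupE by blast
      then show "ball_volume (s - ?e n) \<le> c"
        using monoD[OF mono_ball_volume, of "s - ?e n" r] by (simp add: S_def del: of_nat_Suc)
    qed
    finally show ?thesis .
  qed
  moreover have "c \<le> ball_volume s"
  proof -
    have "emeasure M {x \<in> space M. radius x \<le> s} = (INF n. ball_volume (s + ?e n))"
      using finite_ball emeasure_le_INF[of radius M s]
      by (simp add: ball_volume_def base_ball_eq)
    moreover have "c \<le> (INF n. ball_volume (s + ?e n))"
    proof (rule INF_greatest)
      fix n
      have "s + ?e n \<notin> S"
        using cSup_upper[OF _ \<open>bdd_above S\<close>, of "s + ?e n"] by (auto simp: s_def simp del: of_nat_Suc)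
      then show "c \<le> ball_volume (s + ?e n)"
        by (auto simp: S_def)
    qed
    moreover have "emeasure M {x \<in> space M. radius x \<le> s} = ball_volume s"
    proof -
      have "{x \<in> space M. radius x \<le> s} = base_ball X s \<union> {x \<in> space M. radius x = s}"
        by (auto simp: base_ball_eq)
      moreover have "{x \<in> space M. radius x = s} \<in> null_sets M"
      proof (rule null_setsI)
        show "emeasure M {x \<in> space M. radius x = s} = 0"
          using null_sphere[of s] by (simp add: radius_def)
      qed measurable
      ultimately show ?thesis
        by (simp add: ball_volume_def emeasure_Un_null_set)
    qed
    ultimately show ?thesis by simp
  qed
  ultimately show thesis using that by (simp add: antisym)
qed

text \<open>
  The volume enclosed by the sphere through a random point is uniformly distributed: the ball of
  volume \<open>b\<close> contains the strict and is contained in the weak sublevel set at \<open>b\<close>, and letting \<open>b\<close>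
  approach \<open>c\<close> from either side gives both values.
\<close>

lemma
  assumes c: "c \<le> emeasure M (space M)"
  shows emeasure_enclosed_less: "emeasure M {x \<in> space M. enclosed x < c} = c"
    and emeasure_enclosed_le: "emeasure M {x \<in> space M. enclosed x \<le> c} = c"
proof -
  have below: "emeasure M {x \<in> space M. enclosed x < b} \<le> b"
    and above: "b \<le> emeasure M {x \<in> space M. enclosed x \<le> b}" if b: "b < emeasure M (space M)" for b
  proof -
    obtain r where r: "ball_volume r = b" using ball_volume_attains[OF b] .
    have "{x \<in> space M. enclosed x < b} \<subseteq> base_ball X r"
      using monoD[OF mono_ball_volume, of r] r
      by (force simp: base_ball_eq enclosed_def not_less[symmetric])
    from emeasure_mono[OF this, of M] show "emeasure M {x \<in> space M. enclosed x < b} \<le> b"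
      using r by (simp add: ball_volume_def)
    have "base_ball X r \<subseteq> {x \<in> space M. enclosed x \<le> b}"
      using monoD[OF mono_ball_volume] r by (force simp: base_ball_eq enclosed_def)
    from emeasure_mono[OF this, of M] show "b \<le> emeasure M {x \<in> space M. enclosed x \<le> b}"
      using r by (simp add: ball_volume_def)
  qed
  have le: "emeasure M {x \<in> space M. enclosed x \<le> c} \<le> c"
  proof (cases "c < emeasure M (space M)")
    case True
    show ?thesis
    proof (rule dense_ge_bounded[OF True])
      fix b assume b: "c < b" "b < emeasure M (space M)"
      have "emeasure M {x \<in> space M. enclosed x \<le> c} \<le> emeasure M {x \<in> space M. enclosed x < b}"
        using b by (intro emeasure_mono) auto
      also have "\<dots> \<le> b" using below b by blast
      finally show "emeasure M {x \<in> space M. enclosed x \<le> c} \<le> b" .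
    qed
  next
    case False
    with c have "c = emeasure M (space M)" by simp
    then show ?thesis by (auto intro!: emeasure_space)
  qed
  moreover have ge: "c \<le> emeasure M {x \<in> space M. enclosed x < c}"
  proof (rule dense_le)
    fix b assume b: "b < c"
    then have "b \<le> emeasure M {x \<in> space M. enclosed x \<le> b}"
      using above c by simp
    also have "\<dots> \<le> emeasure M {x \<in> space M. enclosed x < c}"
      using b by (intro emeasure_mono) auto
    finally show "b \<le> emeasure M {x \<in> space M. enclosed x < c}" .
  qed
  moreover have "emeasure M {x \<in> space M. enclosed x < c} \<le> emeasure M {x \<in> space M. enclosed x \<le> c}"
    by (intro emeasure_mono) auto
  ultimately show "emeasure M {x \<in> space M. enclosed x < c} = c"
    "emeasure M {x \<in> space M. enclosed x \<le> c} = c" by auto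
qed

lemma AE_enclosed_pos: "AE x in M. 0 < enclosed x"
proof -
  have "{x \<in> space M. enclosed x \<le> 0} \<in> null_sets M"
    by (intro null_setsI emeasure_enclosed_le) auto
  from AE_not_in[OF this] AE_space show ?thesis
    by eventually_elim (auto simp: zero_less_iff_neq_zero)
qed

end

locale vanishing_function = radial_space X for X :: "'a pointed_space" +
  fixes u :: "'a \<Rightarrow> real"
  assumes measurable_u [measurable]: "u \<in> borel_measurable (volume X)"
    and vanishes: "vanishes_at_infinity X u"
begin

definition superlevel_volume :: "real \<Rightarrow> ennreal" where
  "superlevel_volume t = emeasure M {x \<in> space M. u x > t}"

lemma antimono_superlevel_volume: "antimono superlevel_volume"
  by (intro antimonoI) (auto simp: superlevel_volume_def intro!: emeasure_mono)

lemma superlevel_volume_le_space: "superlevel_volume t \<le> emeasure M (space M)"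
  by (simp add: superlevel_volume_def emeasure_space)

lemma superlevel_volume_finite: "0 < t \<Longrightarrow> superlevel_volume t < \<infinity>"
  using vanishes by (simp add: superlevel_volume_def vanishes_at_infinity_def)

lemma superlevel_volume_right_continuous:
  assumes "y < superlevel_volume s"
  obtains t where "s < t" "y < superlevel_volume t"
proof -
  let ?e = "\<lambda>n. inverse (real (Suc n))"
  have "superlevel_volume s = (SUP n. superlevel_volume (s + ?e n))"
    using emeasure_greater_SUP[of u M s] by (simp add: superlevel_volume_def)
  then obtain n where "y < superlevel_volume (s + ?e n)"
    using assms by (auto simp: less_SUP_iff)
  with that[of "s + ?e n"] show thesis by (simp del: of_nat_Suc)
qed

lemma superlevel_volume_arbitrarily_small:
  assumes "0 < y"
  obtains t where "0 < t" "superlevel_volume t < y"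
proof -
  have fin: "emeasure M {x \<in> space M. u x > real (Suc n)} \<noteq> \<infinity>" for n
    using superlevel_volume_finite[of "real (Suc n)"] unfolding superlevel_volume_def
    by (simp add: less_top del: of_nat_Suc)
  have "decseq (\<lambda>n. {x \<in> space M. u x > real (Suc n)})"
    by (intro decseq_SucI) auto
  then have "(INF n. emeasure M {x \<in> space M. u x > real (Suc n)})
      = emeasure M (\<Inter>n. {x \<in> space M. u x > real (Suc n)})"
    by (intro INF_emeasure_decseq fin) auto
  also have "(\<Inter>n. {x \<in> space M. u x > real (Suc n)}) = {}"
  proof -
    have "\<exists>n. \<not> u x > real (Suc n)" for x
      using real_arch_simple[of "u x - 1"] by (auto simp: not_less algebra_simps)
    then show ?thesis by blast
  qed
  finally have "(INF n. superlevel_volume (real (Suc n))) < y"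
    using assms by (simp add: superlevel_volume_def)
  then obtain n where "superlevel_volume (real (Suc n)) < y"
    by (auto simp: INF_less_iff simp del: of_nat_Suc)
  with that[of "real (Suc n)"] show thesis
    by (simp del: of_nat_Suc add: of_nat_0_less_iff)
qed

definition levels :: "real \<Rightarrow> real set" where
  "levels r = {t. 0 \<le> t \<and> superlevel_volume t \<ge> ball_volume r}"

lemma rearrangement_eq: "rearrangement X u x = enn2real (SUP t\<in>levels (radius x). ennreal t)"
  by (simp add: rearrangement_def levels_def superlevel_volume_def ball_volume_def radius_def)

lemma antimono_levels: "r \<le> s \<Longrightarrow> levels s \<subseteq> levels r"
  using monoD[OF mono_ball_volume, of r s] by (auto simp: levels_def)

lemma measurable_rearrangement [measurable]: "rearrangement X u \<in> borel_measurable M"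
proof -
  \<comment> \<open>The rearrangement is a monotone function of the radius before \<^const>\<open>enn2real\<close> is applied.\<close>
  have "(\<lambda>r. SUP t\<in>levels r. ennreal t) \<in> borel_measurable borel"
    by (intro borel_measurable_antimono_ennreal antimonoI SUP_subset_mono antimono_levels) auto
  then show ?thesis
    unfolding rearrangement_eq[abs_def] by measurable
qed

lemma rearrangement_nonneg: "0 \<le> rearrangement X u x"
  by (simp add: rearrangement_eq)

lemma rearrangement_SUP:
  assumes "0 < enclosed x"
  shows "ennreal (rearrangement X u x) = (SUP t\<in>levels (radius x). ennreal t)"
proof -
  obtain t0 where t0: "0 < t0" "superlevel_volume t0 < enclosed x"
    using superlevel_volume_arbitrarily_small[OF assms] .
  have "(SUP t\<in>levels (radius x). ennreal t) \<le> ennreal t0"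
  proof (intro SUP_least ennreal_leI)
    fix t assume "t \<in> levels (radius x)"
    then show "t \<le> t0"
      using t0 antimonoD[OF antimono_superlevel_volume, of t0 t] by (force simp: levels_def enclosed_def)
  qed
  then show ?thesis
    unfolding rearrangement_eq by (simp add: le_less_trans[OF _ ennreal_less_top])
qed

lemma enclosed_le_superlevel_volume:
  assumes "0 < enclosed x" "0 \<le> s" "s < rearrangement X u x"
  shows "enclosed x \<le> superlevel_volume s"
proof -
  have "ennreal s < (SUP t\<in>levels (radius x). ennreal t)"
    using assms by (simp flip: rearrangement_SUP add: ennreal_lessI)
  then obtain t where "t \<in> levels (radius x)" "s < t"
    using assms(2) by (auto simp: less_SUP_iff ennreal_less_iff)
  then show ?thesis
    using antimonoD[OF antimono_superlevel_volume, of s t] by (auto simp: levels_def enclosed_def)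
qed

text \<open>
  This and the preceding lemma place the superlevel set of the rearrangement between two balls of
  the same volume, which gives equimeasurability.
\<close>

lemma less_rearrangement:
  assumes "0 < enclosed x" "0 \<le> s" "enclosed x < superlevel_volume s"
  shows "s < rearrangement X u x"
proof -
  obtain t where t: "s < t" "enclosed x < superlevel_volume t"
    using superlevel_volume_right_continuous[OF assms(3)] .
  then have "ennreal t \<le> (SUP t\<in>levels (radius x). ennreal t)"
    using assms(2) by (intro SUP_upper) (auto simp: levels_def enclosed_def)
  then have "t \<le> rearrangement X u x"
    by (simp flip: rearrangement_SUP[OF assms(1)] add: ennreal_le_iff[OF rearrangement_nonneg])
  with t(1) show ?thesis by simp
qed

lemma rearrangement_antimono:
  assumes "0 < enclosed x" "enclosed x \<le> enclosed x'"
  shows "rearrangement X u x' \<le> rearrangement X u x"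
proof -
  have "levels (radius x') \<subseteq> levels (radius x)"
    using assms(2) by (auto simp: levels_def enclosed_def)
  then have "ennreal (rearrangement X u x') \<le> ennreal (rearrangement X u x)"
    using assms by (simp add: rearrangement_SUP SUP_subset_mono)
  then show ?thesis
    by (simp add: ennreal_le_iff rearrangement_nonneg)
qed

lemma emeasure_rearrangement:
  assumes "0 \<le> s"
  shows "emeasure M {x \<in> space M. rearrangement X u x > s} = superlevel_volume s"
proof (rule antisym)
  have "emeasure M {x \<in> space M. rearrangement X u x > s}
      \<le> emeasure M {x \<in> space M. enclosed x \<le> superlevel_volume s}"
    using AE_enclosed_pos
    by (intro emeasure_mono_AE) (auto elim!: eventually_mono intro: enclosed_le_superlevel_volume assms)
  then show "emeasure M {x \<in> space M. rearrangement X u x > s} \<le> superlevel_volume s"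
    by (simp add: emeasure_enclosed_le superlevel_volume_le_space)
  have "emeasure M {x \<in> space M. enclosed x < superlevel_volume s}
      \<le> emeasure M {x \<in> space M. rearrangement X u x > s}"
    using AE_enclosed_pos
    by (intro emeasure_mono_AE) (auto elim!: eventually_mono intro: less_rearrangement assms)
  then show "superlevel_volume s \<le> emeasure M {x \<in> space M. rearrangement X u x > s}"
    by (simp add: emeasure_enclosed_less superlevel_volume_le_space)
qed

text \<open>
  A set of finite volume \<open>c\<close> that is comparable by inclusion to the ball of volume \<open>c\<close> agrees with
  it up to a null set. The hypothesis says that no point with a small value lies inside
  a point with a larger value, and this makes each superlevel set of \<open>u\<close> comparable to
  its ball.
\<close>

lemma radially_ordered_imp_eq_rearrangement:
  assumes nonneg: "\<And>x. x \<in> space M \<Longrightarrow> 0 \<le> u x"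
    and E: "AE x in M. x \<in> E"
    and ordered: "\<And>x x'. x \<in> E \<Longrightarrow> x' \<in> E \<Longrightarrow> enclosed x < enclosed x' \<Longrightarrow> u x' \<le> u x"
  shows "AE x in M. u x = rearrangement X u x"
proof -
  have ae: "AE x in M. u x > t \<longleftrightarrow> rearrangement X u x > t" if t: "0 < t" for t
  proof -
    let ?c = "superlevel_volume t"
    let ?U = "{x \<in> space M. u x > t}" and ?W = "{x \<in> space M. rearrangement X u x > t}"
    let ?L = "{x \<in> space M. enclosed x < ?c}" and ?K = "{x \<in> space M. enclosed x \<le> ?c}"
    have meas: "emeasure M ?U = ?c" "emeasure M ?W = ?c" "emeasure M ?L = ?c" "emeasure M ?K = ?c"
      using t by (auto simp: superlevel_volume_def[symmetric] emeasure_rearrangement emeasure_enclosed_less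
          emeasure_enclosed_le superlevel_volume_le_space)
    have fin: "?c < \<infinity>" using superlevel_volume_finite[OF t] .
    \<comment> \<open>The balls \<open>{V \<le> c}\<close> and \<open>{V < c}\<close> have the same finite volume.\<close>
    have KL: "AE x in M. x \<in> ?K \<longrightarrow> x \<in> ?L"
      by (rule AE_subset_of_emeasure_le) (use meas fin in auto)
    have UL: "AE x in M. x \<in> ?U \<longleftrightarrow> x \<in> ?L"
    proof (cases "\<exists>x\<in>E. enclosed x < ?c \<and> u x \<le> t")
      case True
      then obtain y where y: "y \<in> E" "enclosed y < ?c" "u y \<le> t" by blast
      have sub: "AE x in M. x \<in> ?U \<longrightarrow> x \<in> ?K"
        using E by eventually_elim (use y ordered in force)
      have "AE x in M. x \<in> ?K \<longrightarrow> x \<in> ?U"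
        by (rule AE_subset_of_emeasure_le[OF _ _ sub]) (use meas fin in auto)
      with sub KL show ?thesis by eventually_elim auto
    next
      case False
      then have sub: "AE x in M. x \<in> ?L \<longrightarrow> x \<in> ?U"
        using E by (auto elim!: eventually_mono simp: not_le)
      have "AE x in M. x \<in> ?U \<longrightarrow> x \<in> ?L"
        by (rule AE_subset_of_emeasure_le[OF _ _ sub]) (use meas fin in auto)
      with sub show ?thesis by eventually_elim auto
    qed
    from UL KL AE_enclosed_pos AE_space show ?thesis
    proof eventually_elim
      case (elim x)
      then show ?case
        using less_rearrangement[of x t] enclosed_le_superlevel_volume[of x t] t by auto
    qed
  qed
  have "AE x in M. \<forall>q\<in>{q::rat. 0 < q}. u x > of_rat q \<longleftrightarrow> rearrangement X u x > of_rat q"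
    by (subst AE_ball_countable) (auto intro!: ae)
  then show ?thesis
    using AE_space
  proof eventually_elim
    case (elim x)
    have *: "a \<le> b" if "0 \<le> b" "\<And>q::rat. 0 < q \<Longrightarrow> of_rat q < a \<Longrightarrow> of_rat q < b" for a b :: real
    proof (rule ccontr)
      assume "\<not> a \<le> b"
      then obtain q :: rat where "b < of_rat q" "of_rat q < a"
        using of_rat_dense[of b a] by auto
      with that show False
        by (metis less_asym order_le_less_trans zero_less_of_rat_iff)
    qed
    show ?case
    proof (rule antisym)
      show "u x \<le> rearrangement X u x"
        by (rule *[OF rearrangement_nonneg]) (use elim in blast)
      show "rearrangement X u x \<le> u x"
        by (rule *[OF nonneg]) (use elim in blast)+
    qed
  qed
qed

end

section \<open>The three model spaces\<close>

text \<open>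
  All requirements concern the distribution of the distance to the base point, which an
  isomorphism preserves.
\<close>

lemma radial_space_isomorphic:
  assumes iso: "isomorphic X Y" and Y: "radial_space Y"
  shows "radial_space X"
proof -
  interpret Y: radial_space Y by fact
  obtain \<phi> where \<phi> [measurable]: "\<phi> \<in> volume X \<rightarrow>\<^sub>M volume Y"
    and distr: "distr (volume X) (volume Y) \<phi> = volume Y"
    and dist: "\<And>x x'. x \<in> points X \<Longrightarrow> x' \<in> points X \<Longrightarrow>
      distance Y (\<phi> x) (\<phi> x') = distance X x x'"
    and base: "\<phi> (basepoint X) = basepoint Y" "basepoint X \<in> points X"
    using iso unfolding isomorphic_def by blast
  have radius: "distance X x (basepoint X) = Y.radius (\<phi> x)" if "x \<in> points X" for x
    using dist[OF that base(2)] base(1) by (simp add: Y.radius_def)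
  have points: "\<phi> x \<in> points Y" if "x \<in> points X" for x
    using measurable_space[OF \<phi> that] .
  have eq: "emeasure (volume X) {x \<in> points X. distance X x (basepoint X) \<in> B}
      = emeasure (volume Y) {y \<in> points Y. Y.radius y \<in> B}" if [measurable]: "B \<in> sets borel" for B
  proof -
    have "emeasure (volume Y) {y \<in> points Y. Y.radius y \<in> B}
        = emeasure (distr (volume X) (volume Y) \<phi>) {y \<in> points Y. Y.radius y \<in> B}"
      by (simp add: distr)
    also have "\<dots> = emeasure (volume X) (\<phi> -` {y \<in> points Y. Y.radius y \<in> B} \<inter> points X)"
      by (rule emeasure_distr) measurable
    also have "\<phi> -` {y \<in> points Y. Y.radius y \<in> B} \<inter> points X
        = {x \<in> points X. distance X x (basepoint X) \<in> B}"
      using radius points by auto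
    finally show ?thesis ..
  qed
  show ?thesis
  proof
    show "(\<lambda>x. distance X x (basepoint X)) \<in> borel_measurable (volume X)"
      by (subst measurable_cong[OF radius]) measurable
    show "0 \<le> distance X x (basepoint X)" if "x \<in> points X" for x
      using Y.radius_nonneg[OF points[OF that]] radius[OF that] by (simp add: Y.radius_def)
    show "emeasure (volume X) (base_ball X r) < \<infinity>" for r
      using eq[of "{..<r}"] Y.finite_ball[of r] by (simp add: base_ball_def Y.radius_def)
    show "emeasure (volume X) {x \<in> points X. distance X x (basepoint X) = r} = 0" for r
      using eq[of "{r}"] Y.null_sphere[of r] by (simp add: Y.radius_def)
  qed
qed

lemma negligible_constant_norm:
  fixes A :: "'a::euclidean_space set"
  assumes "\<And>y z. y \<in> A \<Longrightarrow> z \<in> A \<Longrightarrow> norm y = norm z"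
  shows "negligible A"
proof (cases "A = {}")
  case False
  then obtain y where "y \<in> A" by blast
  have "A \<subseteq> sphere 0 (norm y)"
  proof
    fix z assume "z \<in> A"
    from assms[OF this \<open>y \<in> A\<close>] show "z \<in> sphere 0 (norm y)" by simp
  qed
  then show ?thesis
    using negligible_sphere negligible_subset by blast
qed simp

lemma radial_space_euclidean: "radial_space (euclidean_model :: (real ^ 'n) pointed_space)"
proof
  let ?X = "euclidean_model :: (real ^ 'n) pointed_space"
  show "(\<lambda>x. distance ?X x (basepoint ?X)) \<in> borel_measurable (volume ?X)"
    unfolding euclidean_model_def by (auto intro!: measurable_completion)
  show "0 \<le> distance ?X x (basepoint ?X)" for x
    by (simp add: euclidean_model_def)
  show "emeasure (volume ?X) (base_ball ?X r) < \<infinity>" for r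
  proof -
    have "base_ball ?X r = ball 0 r"
      by (auto simp: base_ball_def euclidean_model_def)
    then show ?thesis
      using emeasure_lborel_ball_finite[of "0 :: real ^ 'n" r] by (simp add: euclidean_model_def)
  qed
  show "emeasure (volume ?X) {x \<in> points ?X. distance ?X x (basepoint ?X) = r} = 0" for r
  proof -
    have "negligible {x \<in> points ?X. distance ?X x (basepoint ?X) = r}"
      by (rule negligible_constant_norm) (auto simp: euclidean_model_def)
    then show ?thesis
      by (simp add: negligible_iff_null_sets null_sets_def euclidean_model_def)
  qed
qed

text \<open>
  The density is bounded on the ball of radius \<open>2 ^ k\<close> minus the ball of radius \<open>2 ^ (k - 1)\<close> by
  \<open>(8 / 4 ^ k) ^ n\<close>, and on the unit ball by \<open>8 ^ n\<close>. The volume of the larger ball grows like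
  \<open>2 ^ (k n)\<close>, so the contributions form a geometric series.
\<close>

lemma spherical_density_finite:
  "(\<integral>\<^sup>+y. ennreal ((2 / (1 + (norm (y :: real ^ 'n))\<^sup>2)) ^ CARD('n)) \<partial>lborel) < \<infinity>"
proof -
  let ?n = "CARD('n)"
  let ?d = "\<lambda>y :: real ^ 'n. (2 / (1 + (norm y)\<^sup>2)) ^ ?n"
  define a :: "nat \<Rightarrow> real" where "a k = (8 / 4 ^ k) ^ ?n" for k
  have a_nonneg: "0 \<le> a k" for k by (simp add: a_def)
  have bound: "ennreal (?d y) \<le> (\<Sum>k. ennreal (a k) * indicator (ball 0 (2 ^ k)) y)" for y
  proof -
    define k where "k = (LEAST k. norm y < 2 ^ k)"
    have "\<exists>k. norm y < 2 ^ k"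
      using real_arch_pow[of 2 "norm y"] by simp
    then have k: "norm y < 2 ^ k"
      unfolding k_def by (rule LeastI_ex)
    have "?d y \<le> a k"
      unfolding a_def
    proof (rule power_mono)
      show "2 / (1 + (norm y)\<^sup>2) \<le> 8 / 4 ^ k"
      proof (cases k)
        case 0
        have "2 / (1 + (norm y)\<^sup>2) \<le> 2 / 1"
          by (intro divide_left_mono) (auto intro: add_pos_nonneg)
        with 0 show ?thesis by simp
      next
        case (Suc j)
        then have "2 ^ j \<le> norm y"
          unfolding k_def by (metis lessI not_less not_less_Least)
        then have "(2 ^ j)\<^sup>2 \<le> (norm y)\<^sup>2"
          by (intro power_mono) auto
        then have "4 ^ j \<le> 1 + (norm y)\<^sup>2"
          by (simp add: power2_eq_square flip: power_mult_distrib)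
        then have "2 / (1 + (norm y)\<^sup>2) \<le> 2 / 4 ^ j"
          by (intro divide_left_mono) (auto intro!: mult_pos_pos add_pos_nonneg)
        with Suc show ?thesis by simp
      qed
    qed simp
    then have "ennreal (?d y) \<le> ennreal (a k) * indicator (ball 0 (2 ^ k)) y"
      using k by (simp add: ennreal_leI)
    also have "\<dots> \<le> (\<Sum>k. ennreal (a k) * indicator (ball 0 (2 ^ k)) y)"
    proof -
      have "f k \<le> (\<Sum>k. f k)" for f :: "nat \<Rightarrow> ennreal"
        using sum_le_suminf[OF summableI, of "{k}" f] by simp
      then show ?thesis .
    qed
    finally show ?thesis .
  qed
  have "(\<integral>\<^sup>+y. ennreal (?d y) \<partial>lborel)
      \<le> (\<integral>\<^sup>+y. (\<Sum>k. ennreal (a k) * indicator (ball 0 (2 ^ k)) (y :: real ^ 'n)) \<partial>lborel)"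
    by (intro nn_integral_mono bound)
  also have "\<dots> = (\<Sum>k. \<integral>\<^sup>+y. ennreal (a k) * indicator (ball 0 (2 ^ k)) (y :: real ^ 'n) \<partial>lborel)"
    by (intro nn_integral_suminf borel_measurable_times_ennreal borel_measurable_const
        borel_measurable_indicator) simp
  also have "\<dots> = (\<Sum>k. ennreal (unit_ball_vol (real ?n) * 8 ^ ?n * ((1 / 2) ^ ?n) ^ k))"
  proof (rule suminf_cong)
    fix k
    have "(\<integral>\<^sup>+y. ennreal (a k) * indicator (ball 0 (2 ^ k)) (y :: real ^ 'n) \<partial>lborel)
        = ennreal (a k) * emeasure lborel (ball (0 :: real ^ 'n) (2 ^ k))"
      by (rule nn_integral_cmult_indicator) simp
    also have "\<dots> = ennreal (a k * (unit_ball_vol (real ?n) * (2 ^ k) ^ ?n))"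
      using a_nonneg by (subst emeasure_ball) (auto simp: ennreal_mult')
    also have "a k * (unit_ball_vol (real ?n) * (2 ^ k) ^ ?n)
        = unit_ball_vol (real ?n) * (8 / 4 ^ k * 2 ^ k) ^ ?n"
      unfolding a_def power_mult_distrib by (rule mult.left_commute)
    also have "8 / 4 ^ k * 2 ^ k = 8 * (1 / 2 :: real) ^ k"
    proof -
      have "(4 :: real) ^ k = 2 ^ k * 2 ^ k" by (simp flip: power_mult_distrib)
      then show ?thesis by (simp add: power_divide)
    qed
    also have "(8 * (1 / 2 :: real) ^ k) ^ ?n = 8 ^ ?n * ((1 / 2) ^ ?n) ^ k"
      by (simp add: power_mult_distrib flip: power_mult) (simp add: mult.commute)
    finally show "(\<integral>\<^sup>+y. ennreal (a k) * indicator (ball 0 (2 ^ k)) (y :: real ^ 'n) \<partial>lborel)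
        = ennreal (unit_ball_vol (real ?n) * 8 ^ ?n * ((1 / 2) ^ ?n) ^ k)"
      by (simp add: mult.assoc)
  qed
  also have "\<dots> < \<infinity>"
  proof -
    have "((1 / 2 :: real) ^ ?n) < 1"
      by (simp add: power_less_one_iff)
    then have "summable (\<lambda>k. unit_ball_vol (real ?n) * 8 ^ ?n * ((1 / 2) ^ ?n) ^ k)"
      by (intro summable_mult summable_geometric) simp
    then have "(\<Sum>k. ennreal (unit_ball_vol (real ?n) * 8 ^ ?n * ((1 / 2) ^ ?n) ^ k)) \<noteq> top"
      by (intro ennreal_suminf_neq_top) auto
    then show ?thesis by (simp add: less_top)
  qed
  finally show ?thesis .
qed

lemma inverse_stereographic_inner_pole:
  "inverse_stereographic y \<bullet> (0, 1) = (1 - (norm y)\<^sup>2) / (1 + (norm y)\<^sup>2)"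
  by (simp add: inverse_stereographic_def)

lemma measurable_inverse_stereographic:
  "(inverse_stereographic :: real ^ 'n \<Rightarrow> _) \<in> borel \<rightarrow>\<^sub>M restrict_space borel (sphere 0 1)"
proof (rule measurable_restrict_space2)
  show "inverse_stereographic \<in> borel \<rightarrow>\<^sub>M borel"
    unfolding inverse_stereographic_def[abs_def]
    by (intro borel_measurable_continuous_onI continuous_intros) (auto simp: add_nonneg_eq_0_iff)
qed (simp add: inverse_stereographic_in_sphere[simplified])

text \<open>
  In the chart the distance to the base point is an injective function of the norm, so that
  spheres around the base point are null sets. The total volume is finite.
\<close>

lemma radial_space_spherical:
  "radial_space (spherical_model :: ((real ^ 'n) \<times> real) pointed_space)"
proof -
  let ?X = "spherical_model :: ((real ^ 'n) \<times> real) pointed_space"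
  define N where "N = density lborel (\<lambda>y :: real ^ 'n. ennreal ((2 / (1 + (norm y)\<^sup>2)) ^ CARD('n)))"
  define S where "S = distr N (restrict_space borel (sphere 0 1)) inverse_stereographic"
  have T: "inverse_stereographic \<in> N \<rightarrow>\<^sub>M restrict_space borel (sphere 0 1)"
    using measurable_inverse_stereographic by (simp add: N_def)
  have X: "volume ?X = completion S" "points ?X = sphere 0 1"
    "distance ?X x (basepoint ?X) = arccos (x \<bullet> (0, 1))" for x
    by (simp_all add: spherical_model_def S_def N_def space_restrict_space)
  have sphere: "\<bar>x \<bullet> (0, 1)\<bar> \<le> 1" if "x \<in> sphere 0 1" for x :: "(real ^ 'n) \<times> real"
    using Cauchy_Schwarz_ineq2[of x "(0, 1)"] that by (simp add: norm_Pair)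
  have radius: "(\<lambda>x. arccos (x \<bullet> (0, 1))) \<in> borel_measurable (restrict_space borel (sphere (0 :: (real ^ 'n) \<times> real) 1))"
    by (intro borel_measurable_continuous_on_restrict continuous_intros)
       (use sphere in \<open>auto simp: abs_le_iff\<close>)
  then have radius_S [measurable]: "(\<lambda>x. arccos (x \<bullet> (0, 1))) \<in> borel_measurable S"
    by (simp add: S_def)
  have space_S: "space S = sphere 0 1"
    by (simp add: S_def space_restrict_space)
  have completion_eq: "emeasure (completion S) A = emeasure S A" if "A \<in> sets S" for A
    using that by simp
  have emeasure_N: "emeasure N UNIV < \<infinity>"
    unfolding N_def using spherical_density_finite[where 'n = 'n]
    by (subst emeasure_density) auto
  show ?thesis
  proof
    show "(\<lambda>x. distance ?X x (basepoint ?X)) \<in> borel_measurable (volume ?X)"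
      unfolding X using radius_S by (rule measurable_completion)
    show "0 \<le> distance ?X x (basepoint ?X)" if "x \<in> points ?X" for x
      using sphere[of x] that unfolding X(2,3) by (intro arccos_lbound) (auto simp: abs_le_iff)
    show "emeasure (volume ?X) (base_ball ?X r) < \<infinity>" for r
    proof -
      let ?A = "{x \<in> space S. arccos (x \<bullet> (0, 1)) < r}"
      have "base_ball ?X r = ?A"
        by (auto simp: base_ball_def X space_S)
      then have "emeasure (volume ?X) (base_ball ?X r) = emeasure (completion S) ?A"
        by (simp only: X(1))
      also have "\<dots> = emeasure S ?A"
        by (rule completion_eq) measurable
      also have "\<dots> \<le> emeasure S (space S)"
        by (rule emeasure_space)
      also have "\<dots> = emeasure N UNIV"
      proof -
        have "emeasure S (space S) = emeasure N (inverse_stereographic -` space S \<inter> space N)"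
          using emeasure_distr[OF T, of "space S"] sets.top[of S] by (simp add: S_def)
        also have "inverse_stereographic -` space S \<inter> space N = UNIV"
          using inverse_stereographic_in_sphere
          by (auto simp: space_S N_def simp del: mem_sphere_0)
        finally show ?thesis .
      qed
      finally show ?thesis using emeasure_N by simp
    qed
    show "emeasure (volume ?X) {x \<in> points ?X. distance ?X x (basepoint ?X) = r} = 0" for r
    proof -
      let ?A = "{x \<in> space S. arccos (x \<bullet> (0, 1)) = r}"
      let ?B = "inverse_stereographic -` ?A \<inter> space N"
      have A: "?A \<in> sets (restrict_space borel (sphere 0 1))"
      proof -
        have "?A \<in> sets S" by measurable
        moreover have "sets S = sets (restrict_space borel (sphere 0 1))"
          by (simp add: S_def)
        ultimately show ?thesis by simp
      qed
      have "{x \<in> points ?X. distance ?X x (basepoint ?X) = r} = ?A"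
        by (auto simp: X space_S)
      then have "emeasure (volume ?X) {x \<in> points ?X. distance ?X x (basepoint ?X) = r}
          = emeasure (completion S) ?A"
        by (simp only: X(1))
      also have "\<dots> = emeasure S ?A"
        by (rule completion_eq) measurable
      also have "\<dots> = emeasure N ?B"
        using emeasure_distr[OF T A] by (simp only: S_def[symmetric])
      also have "\<dots> = 0"
      proof -
        have B: "?B \<in> sets borel"
          using measurable_sets[OF measurable_inverse_stereographic A]
          by (simp only: N_def space_density space_lborel space_borel)
        have "negligible ?B"
        proof (rule negligible_constant_norm)
          fix y z assume "y \<in> ?B" "z \<in> ?B"
          then have "arccos ((1 - (norm y)\<^sup>2) / (1 + (norm y)\<^sup>2)) = arccos ((1 - (norm z)\<^sup>2) / (1 + (norm z)\<^sup>2))"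
            by (simp add: inverse_stereographic_inner_pole)
          moreover have "\<bar>(1 - (norm v)\<^sup>2) / (1 + (norm v)\<^sup>2)\<bar> \<le> 1" for v :: "real ^ 'n"
            using sphere[OF inverse_stereographic_in_sphere, of v] by (simp only: inverse_stereographic_inner_pole)
          ultimately have "(1 - (norm y)\<^sup>2) / (1 + (norm y)\<^sup>2) = (1 - (norm z)\<^sup>2) / (1 + (norm z)\<^sup>2)"
            by (simp only: arccos_eq_iff)
          moreover have "0 < 1 + (norm v)\<^sup>2" for v :: "real ^ 'n"
            by (intro add_pos_nonneg) auto
          ultimately have "(1 - (norm y)\<^sup>2) * (1 + (norm z)\<^sup>2) = (1 - (norm z)\<^sup>2) * (1 + (norm y)\<^sup>2)"
            by (simp add: frac_eq_eq less_imp_neq[symmetric])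
          then have "(norm y)\<^sup>2 = (norm z)\<^sup>2"
            by (simp add: algebra_simps)
          then show "norm y = norm z"
            by (rule power2_eq_imp_eq) auto
        qed
        then have "?B \<in> null_sets lborel"
          using B by (simp add: negligible_iff_null_sets null_sets_completion_iff)
        then show ?thesis
          unfolding N_def by (subst emeasure_density) (use B in \<open>auto simp: N_def intro!: nn_integral_null_set\<close>)
      qed
      finally show ?thesis .
    qed
  qed
qed

text \<open>
  A bound on the hyperbolic distance to the base point keeps \<open>1 / (1 - |y|\<^sup>2)\<close> and therefore the
  density bounded; hence balls have finite volume.
\<close>

lemma radial_space_hyperbolic:
  "radial_space (hyperbolic_model :: (real ^ 'n) pointed_space)"
proof -
  let ?X = "hyperbolic_model :: (real ^ 'n) pointed_space"
  let ?B = "ball (0 :: real ^ 'n) 1"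
  define L where "L = lebesgue_on ?B"
  define v :: "real ^ 'n \<Rightarrow> real" where "v y = 1 + 2 * (norm y)\<^sup>2 / (1 - (norm y)\<^sup>2)" for y
  define g :: "real ^ 'n \<Rightarrow> real" where "g y = (2 / (1 - (norm y)\<^sup>2)) ^ CARD('n)" for y
  have X: "volume ?X = density L (\<lambda>y. ennreal (g y))" "points ?X = ?B"
    "distance ?X y (basepoint ?X) = arcosh (v y)" for y
    by (simp_all add: hyperbolic_model_def L_def g_def v_def space_restrict_space)
  have pos: "0 < 1 - (norm y)\<^sup>2" if "y \<in> ?B" for y
    using that by (simp add: abs_square_less_1)
  have v1: "1 \<le> v y" if "y \<in> ?B" for y
    using pos[OF that] by (simp add: v_def)
  have v_meas [measurable]: "(\<lambda>y. arcosh (v y)) \<in> borel_measurable L"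
  proof -
    have "continuous_on ?B v"
      unfolding v_def by (intro continuous_intros) (use pos in force)
    then have "continuous_on ?B (\<lambda>y. arcosh (v y))"
      by (rule continuous_on_compose2[OF continuous_on_arcosh[OF order_refl]]) (use v1 in auto)
    then show ?thesis
      unfolding L_def by (intro continuous_imp_measurable_on_sets_lebesgue) auto
  qed
  have g_meas [measurable]: "g \<in> borel_measurable L"
  proof -
    have "continuous_on ?B g"
      unfolding g_def by (intro continuous_intros) (use pos in force)
    then show ?thesis
      unfolding L_def by (intro continuous_imp_measurable_on_sets_lebesgue) auto
  qed
  have space_L: "space L = ?B"
    by (simp add: L_def space_restrict_space)
  show ?thesis
  proof
    show "(\<lambda>x. distance ?X x (basepoint ?X)) \<in> borel_measurable (volume ?X)"
      unfolding X by measurable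
    show "0 \<le> distance ?X x (basepoint ?X)" if "x \<in> points ?X" for x
      using that v1[of x] unfolding X(2,3) by simp
    show "emeasure (volume ?X) (base_ball ?X r) < \<infinity>" for r
    proof -
      let ?A = "{y \<in> space L. arcosh (v y) < r}"
      define c where "c = (2 * cosh r) ^ CARD('n)"
      have bound: "g y \<le> c" if "y \<in> ?A" for y
        unfolding g_def c_def
      proof (rule power_mono)
        have y: "y \<in> ?B" "arcosh (v y) < r"
          using that by (auto simp: space_L)
        have "0 \<le> arcosh (v y)"
          using v1[OF y(1)] by simp
        with y have "cosh (arcosh (v y)) \<le> cosh r"
          by (simp add: cosh_real_nonneg_le_iff)
        then have "v y \<le> cosh r"
          using v1[OF y(1)] by simp
        moreover have "1 / (1 - (norm y)\<^sup>2) \<le> v y"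
          using pos[OF y(1)] by (simp add: v_def field_simps)
        ultimately show "2 / (1 - (norm y)\<^sup>2) \<le> 2 * cosh r"
          by simp
        show "0 \<le> 2 / (1 - (norm y)\<^sup>2)"
          using pos[OF y(1)] by simp
      qed
      have "base_ball ?X r = ?A"
        by (auto simp: base_ball_def X space_L)
      then have "emeasure (volume ?X) (base_ball ?X r) = (\<integral>\<^sup>+y. ennreal (g y) * indicator ?A y \<partial>L)"
        unfolding X by (simp add: emeasure_density)
      also have "\<dots> \<le> (\<integral>\<^sup>+y. ennreal c * indicator (space L) y \<partial>L)"
        using bound by (intro nn_integral_mono) (auto simp: indicator_def intro!: ennreal_leI)
      also have "\<dots> = ennreal c * emeasure L (space L)"
        by (rule nn_integral_cmult_indicator) simp
      also have "emeasure L (space L) = emeasure lborel ?B"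
        unfolding space_L by (simp add: L_def emeasure_restrict_space)
      also have "ennreal c * emeasure lborel ?B < \<infinity>"
        using emeasure_lborel_ball_finite[of "0 :: real ^ 'n" 1] by (simp add: ennreal_mult_less_top)
      finally show ?thesis .
    qed
    show "emeasure (volume ?X) {x \<in> points ?X. distance ?X x (basepoint ?X) = r} = 0" for r
    proof -
      let ?A = "{y \<in> space L. arcosh (v y) = r}"
      have "negligible ?A"
      proof (rule negligible_constant_norm)
        fix y z assume yz: "y \<in> ?A" "z \<in> ?A"
        then have B: "y \<in> ?B" "z \<in> ?B" by (auto simp: space_L)
        have "arcosh (v y) = arcosh (v z)"
          using yz by simp
        then have "v y = v z"
          using cosh_arcosh_real[OF v1[OF B(1)]] cosh_arcosh_real[OF v1[OF B(2)]] by metis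
        then have "(norm y)\<^sup>2 = (norm z)\<^sup>2"
          using pos[OF B(1)] pos[OF B(2)] by (simp add: v_def frac_eq_eq algebra_simps)
        then show "norm y = norm z"
          by (rule power2_eq_imp_eq) auto
      qed
      then have "emeasure L ?A = 0"
        unfolding L_def by (subst emeasure_restrict_space)
          (auto simp: negligible_iff_null_sets null_sets_def space_restrict_space)
      then have "?A \<in> null_sets L"
        by (intro null_setsI) measurable
      moreover have "{x \<in> points ?X. distance ?X x (basepoint ?X) = r} = ?A"
        by (auto simp: X space_L)
      ultimately show ?thesis
        unfolding X by (simp add: emeasure_density nn_integral_null_set)
    qed
  qed
qed

section \<open>The rearrangement inequality\<close>

lemma axis_eq_vec_lambda: "axis i t = (\<chi> l. if l = i then t else 0)"
  by (auto simp: axis_def)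

lemma borel_measurable_axis:
  assumes F: "F \<in> borel_measurable (restrict_space borel nonneg_cone)"
    and w: "w \<in> borel_measurable M" "\<And>x. x \<in> space M \<Longrightarrow> 0 \<le> w x"
  shows "(\<lambda>x. F (axis i (w x))) \<in> borel_measurable M"
  unfolding axis_eq_vec_lambda
  by (rule borel_measurable_on_cone[OF F]) (use w in auto)

lemma axis_zero: "axis i 0 = 0"
  by (simp add: axis_eq_0_iff)

context comonotone_coupling
begin

lemma nn_integral_axis:
  assumes F: "F \<in> borel_measurable (restrict_space borel nonneg_cone)" "F 0 = 0"
    and h [measurable]: "h \<in> borel_measurable borel" and h0: "h 0 = (0 :: ennreal)"
  shows "(\<integral>\<^sup>+x. h (F (axis i (u i x))) \<partial>M) = (\<integral>\<^sup>+x. h (F (axis i (v i x))) \<partial>M)"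
proof -
  have [measurable]: "(\<lambda>t. F (axis i (max 0 t))) \<in> borel_measurable borel"
    by (intro borel_measurable_axis F) auto
  have "(\<integral>\<^sup>+x. h (F (axis i (max 0 (u i x)))) \<partial>M) = (\<integral>\<^sup>+x. h (F (axis i (max 0 (v i x)))) \<partial>M)"
    by (intro nn_integral_coordinate[where f = "\<lambda>t. h (F (axis i (max 0 t)))"])
       (simp_all add: F h0 axis_zero)
  moreover have "(\<integral>\<^sup>+x. h (F (axis i (max 0 (u i x)))) \<partial>M) = (\<integral>\<^sup>+x. h (F (axis i (u i x))) \<partial>M)"
    by (rule nn_integral_cong) (simp add: u_nonneg max_absorb2)
  moreover have "(\<integral>\<^sup>+x. h (F (axis i (max 0 (v i x)))) \<partial>M) = (\<integral>\<^sup>+x. h (F (axis i (v i x))) \<partial>M)"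
    by (rule nn_integral_cong) (simp add: v_nonneg max_absorb2)
  ultimately show ?thesis by simp
qed

end

text \<open>
  The identity \<open>a = e + \<Sum> b\<close> with positive and negative parts separated, in the form of a sum
  of nonnegative terms on both sides that can be integrated without finiteness assumptions.
\<close>

lemma ennreal_excess_balance:
  fixes b :: "'m::finite \<Rightarrow> real"
  assumes "0 \<le> e" and a: "a = e + (\<Sum>i\<in>UNIV. b i)"
  shows "ennreal a + (\<Sum>i\<in>UNIV. ennreal (- b i)) = ennreal e + (\<Sum>i\<in>UNIV. ennreal (b i)) + ennreal (- a)"
proof -
  have pos: "ennreal t = ennreal (max 0 t)" for t
    by (simp add: max_def ennreal_neg)
  have "b i = max 0 (b i) - max 0 (- b i)" for i by auto
  then have "(\<Sum>i\<in>UNIV. b i) = (\<Sum>i\<in>UNIV. max 0 (b i)) - (\<Sum>i\<in>UNIV. max 0 (- b i))"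
    by (simp flip: sum_subtractf)
  then have "max 0 a + (\<Sum>i\<in>UNIV. max 0 (- b i)) = e + (\<Sum>i\<in>UNIV. max 0 (b i)) + max 0 (- a)"
    using a by auto
  then have "ennreal (max 0 a + (\<Sum>i\<in>UNIV. max 0 (- b i)))
      = ennreal (e + (\<Sum>i\<in>UNIV. max 0 (b i)) + max 0 (- a))"
    by simp
  then show ?thesis
    using assms(1) by (subst (1 2 4 5) pos) (simp add: sum_ennreal sum_nonneg ennreal_plus)
qed

text \<open>
  Nonnegativity of the excess bounds the negative part of \<open>F\<close> by the sum of the negative parts on
  the axes; this makes the integral well defined and allows subtracting in the balance of positive
  and negative parts.
\<close>

lemma extended_integral_excess:
  fixes M :: "'a measure" and F :: "real ^ 'm \<Rightarrow> real" and w :: "'m \<Rightarrow> 'a \<Rightarrow> real"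
  defines "p \<equiv> \<Sum>i\<in>UNIV. \<integral>\<^sup>+x. ennreal (F (axis i (w i x))) \<partial>M"
    and "n \<equiv> \<Sum>i\<in>UNIV. \<integral>\<^sup>+x. ennreal (- F (axis i (w i x))) \<partial>M"
    and "e \<equiv> \<integral>\<^sup>+x. ennreal (excess F (\<chi> i. w i x)) \<partial>M"
  assumes [measurable]: "(\<lambda>x. F (\<chi> i. w i x)) \<in> borel_measurable M"
      "\<And>i. (\<lambda>x. F (axis i (w i x))) \<in> borel_measurable M"
    and nonneg: "\<And>x. x \<in> space M \<Longrightarrow> 0 \<le> excess F (\<chi> i. w i x)"
    and n: "n < \<infinity>"
  shows "(\<integral>\<^sup>+x. ennreal (- F (\<chi> i. w i x)) \<partial>M) < \<infinity>"
    and "extended_integral M (\<lambda>x. F (\<chi> i. w i x)) = enn2ereal e + enn2ereal p - enn2ereal n"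
proof -
  let ?A = "\<integral>\<^sup>+x. ennreal (F (\<chi> i. w i x)) \<partial>M" and ?B = "\<integral>\<^sup>+x. ennreal (- F (\<chi> i. w i x)) \<partial>M"
  have [measurable]: "(\<lambda>x. excess F (\<chi> i. w i x)) \<in> borel_measurable M"
    unfolding excess_def by simp
  have F_eq: "F (\<chi> i. w i x) = excess F (\<chi> i. w i x) + (\<Sum>i\<in>UNIV. F (axis i (w i x)))" for x
    by (simp add: excess_def)
  have n_eq: "n = (\<integral>\<^sup>+x. (\<Sum>i\<in>UNIV. ennreal (- F (axis i (w i x)))) \<partial>M)"
    unfolding n_def by (rule nn_integral_sum[symmetric]) measurable
  have p_eq: "p = (\<integral>\<^sup>+x. (\<Sum>i\<in>UNIV. ennreal (F (axis i (w i x)))) \<partial>M)"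
    unfolding p_def by (rule nn_integral_sum[symmetric]) measurable
  have balance: "ennreal (F (\<chi> i. w i x)) + (\<Sum>i\<in>UNIV. ennreal (- F (axis i (w i x))))
      = ennreal (excess F (\<chi> i. w i x)) + (\<Sum>i\<in>UNIV. ennreal (F (axis i (w i x))))
        + ennreal (- F (\<chi> i. w i x))" if "x \<in> space M" for x
    by (rule ennreal_excess_balance[OF nonneg[OF that] F_eq])
  have "?A + n = (\<integral>\<^sup>+x. ennreal (F (\<chi> i. w i x)) + (\<Sum>i\<in>UNIV. ennreal (- F (axis i (w i x)))) \<partial>M)"
    unfolding n_eq by (rule nn_integral_add[symmetric]) measurable
  also have "\<dots> = (\<integral>\<^sup>+x. (ennreal (excess F (\<chi> i. w i x)) + (\<Sum>i\<in>UNIV. ennreal (F (axis i (w i x)))))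
        + ennreal (- F (\<chi> i. w i x)) \<partial>M)"
    by (rule nn_integral_cong) (rule balance)
  also have "\<dots> = e + p + ?B"
    unfolding e_def p_eq by (simp add: nn_integral_add)
  finally have eq: "?A + n = e + p + ?B" .
  have "?B \<le> n"
    unfolding n_eq
  proof (rule nn_integral_mono)
    fix x assume x: "x \<in> space M"
    have "ennreal (- F (\<chi> i. w i x)) \<le> ennreal (\<Sum>i\<in>UNIV. max 0 (- F (axis i (w i x))))"
    proof (rule ennreal_leI)
      have "- F (\<chi> i. w i x) \<le> (\<Sum>i\<in>UNIV. - F (axis i (w i x)))"
        using nonneg[OF x] by (simp add: F_eq sum_negf)
      also have "\<dots> \<le> (\<Sum>i\<in>UNIV. max 0 (- F (axis i (w i x))))"
        by (intro sum_mono) simp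
      finally show "- F (\<chi> i. w i x) \<le> (\<Sum>i\<in>UNIV. max 0 (- F (axis i (w i x))))" .
    qed
    also have "\<dots> = (\<Sum>i\<in>UNIV. ennreal (- F (axis i (w i x))))"
    proof -
      have "ennreal (max 0 t) = ennreal t" for t
        by (simp add: max_def ennreal_neg)
      then show ?thesis
        using sum_ennreal[of UNIV "\<lambda>i. max 0 (- F (axis i (w i x)))"] by simp
    qed
    finally show "ennreal (- F (\<chi> i. w i x)) \<le> (\<Sum>i\<in>UNIV. ennreal (- F (axis i (w i x))))" .
  qed
  then show B: "?B < \<infinity>"
    using n by simp
  have "enn2ereal ?A + enn2ereal n = enn2ereal e + enn2ereal p + enn2ereal ?B"
    using eq by (simp flip: plus_ennreal.rep_eq)
  moreover obtain b where "enn2ereal ?B = ereal b"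
    using B by (cases ?B) auto
  moreover obtain c where "enn2ereal n = ereal c"
    using n by (cases n) auto
  ultimately show "extended_integral M (\<lambda>x. F (\<chi> i. w i x)) = enn2ereal e + enn2ereal p - enn2ereal n"
    unfolding extended_integral_def
    by (cases "enn2ereal ?A"; cases "enn2ereal e"; cases "enn2ereal p") auto
qed

theorem (in radial_space) supermodular_rearrangement:
  fixes F :: "real ^ 'm \<Rightarrow> real" and u :: "'m \<Rightarrow> 'a \<Rightarrow> real"
  assumes F: "supermodular F" "F \<in> borel_measurable (restrict_space borel nonneg_cone)" "F 0 = 0"
    and u: "\<And>i. u i \<in> borel_measurable M" "\<And>i x. x \<in> space M \<Longrightarrow> 0 \<le> u i x"
      "\<And>i. vanishes_at_infinity X (u i)"
    and neg: "\<And>i. (\<integral>\<^sup>+x. ennreal (- F (axis i (u i x))) \<partial>M) < \<infinity>"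
  defines "I \<equiv> extended_integral M (\<lambda>x. F (\<chi> i. u i x))"
    and "I' \<equiv> extended_integral M (\<lambda>x. F (\<chi> i. rearrangement X (u i) x))"
  shows negative_part_finite: "(\<integral>\<^sup>+x. ennreal (- F (\<chi> i. u i x)) \<partial>M) < \<infinity>"
    and negative_part_rearrangement_finite:
      "(\<integral>\<^sup>+x. ennreal (- F (\<chi> i. rearrangement X (u i) x)) \<partial>M) < \<infinity>"
    and rearrangement_inequality: "I \<le> I'"
    and equality_ordered: "I = I' \<Longrightarrow> \<bar>I\<bar> \<noteq> \<infinity> \<Longrightarrow> i \<noteq> j \<Longrightarrow> strictly_supermodular_in F i j \<Longrightarrow>
      \<exists>E. (AE x in M. x \<in> E) \<and>
        (\<forall>x\<in>E. \<forall>x'\<in>E. (u i x - u i x') * (u j x - u j x') \<ge> 0)"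
proof -
  define v where "v i = rearrangement X (u i)" for i
  have vf: "vanishing_function X (u i)" for i
    by unfold_locales (use u in auto)
  interpret C: comonotone_coupling M u v "{x \<in> space M. 0 < enclosed x}"
  proof
    show "v i \<in> borel_measurable M" for i
      unfolding v_def by (rule vanishing_function.measurable_rearrangement[OF vf])
    show "0 \<le> v i x" for i x
      unfolding v_def by (rule vanishing_function.rearrangement_nonneg[OF vf])
    show "emeasure M {x \<in> space M. u i x > t} = emeasure M {x \<in> space M. v i x > t}"
      if "0 < t" for i t
      using vanishing_function.emeasure_rearrangement[OF vf, of t i] that
      by (simp add: v_def vanishing_function.superlevel_volume_def[OF vf])
    show "emeasure M {x \<in> space M. u i x > t} < \<infinity>" if "0 < t" for i t
      using u(3)[of i] that by (simp add: vanishes_at_infinity_def)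
    show "AE x in M. x \<in> {x \<in> space M. 0 < enclosed x}"
      using AE_enclosed_pos AE_space by eventually_elim simp
    show "(\<forall>i. v i x \<le> v i x') \<or> (\<forall>i. v i x' \<le> v i x)"
      if "x \<in> {x \<in> space M. 0 < enclosed x}" "x' \<in> {x \<in> space M. 0 < enclosed x}" for x x'
      using that vanishing_function.rearrangement_antimono[OF vf]
      unfolding v_def by (metis (no_types, lifting) linear mem_Collect_eq)
  qed (use u in auto)
  let ?\<Phi> = "excess F"
  have \<Phi>: "supermodular ?\<Phi>" "\<And>i t. ?\<Phi> (axis i t) = 0"
    using supermodular_excess[OF F(1)] excess_axis[of F, OF F(3)] by auto
  define p n where
    "p w = (\<Sum>i\<in>UNIV. \<integral>\<^sup>+x. ennreal (F (axis i (w i x))) \<partial>M)"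
    and "n w = (\<Sum>i\<in>UNIV. \<integral>\<^sup>+x. ennreal (- F (axis i (w i x))) \<partial>M)" for w :: "'m \<Rightarrow> 'a \<Rightarrow> real"
  define e where "e w = (\<integral>\<^sup>+x. ennreal (?\<Phi> (\<chi> i. w i x)) \<partial>M)" for w :: "'m \<Rightarrow> 'a \<Rightarrow> real"
  have pv: "p v = p u"
    unfolding p_def by (intro sum.cong refl C.nn_integral_axis[symmetric] F) auto
  have nv: "n v = n u"
    unfolding n_def
    by (intro sum.cong refl C.nn_integral_axis[where h = "\<lambda>t. ennreal (- t)", symmetric] F) auto
  have nu: "n u < \<infinity>"
    unfolding n_def using neg by (simp add: less_top)
  note U = extended_integral_excess[where F = F and w = u and M = M, folded p_def n_def e_def,
      OF borel_measurable_on_cone[OF F(2) C.measurable_u C.u_nonneg]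
        borel_measurable_axis[OF F(2) C.measurable_u C.u_nonneg]
        nonneg_of_zero_on_axes[OF \<Phi> C.U_in_cone] nu]
  note V = extended_integral_excess[where F = F and w = v and M = M, folded p_def n_def e_def,
      OF borel_measurable_on_cone[OF F(2) C.measurable_v C.v_nonneg]
        borel_measurable_axis[OF F(2) C.measurable_v C.v_nonneg]
        nonneg_of_zero_on_axes[OF \<Phi> C.W_in_cone] nu[folded nv], unfolded pv nv]
  show "(\<integral>\<^sup>+x. ennreal (- F (\<chi> i. u i x)) \<partial>M) < \<infinity>"
    using U(1) .
  show "(\<integral>\<^sup>+x. ennreal (- F (\<chi> i. rearrangement X (u i) x)) \<partial>M) < \<infinity>"
    using V(1) by (simp add: v_def)
  have I: "I = enn2ereal (e u) + enn2ereal (p u) - enn2ereal (n u)"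
    and I': "I' = enn2ereal (e v) + enn2ereal (p u) - enn2ereal (n u)"
    using U(2) V(2) by (auto simp: I_def I'_def v_def[symmetric])
  have "e u \<le> e v"
    unfolding e_def by (rule C.nn_integral_le[OF \<Phi>])
  then show "I \<le> I'"
    unfolding I I' by (intro ereal_minus_mono add_right_mono) (auto simp: less_eq_ennreal.rep_eq)
  show "\<exists>E. (AE x in M. x \<in> E) \<and>
        (\<forall>x\<in>E. \<forall>x'\<in>E. (u i x - u i x') * (u j x - u j x') \<ge> 0)"
    if "I = I'" "\<bar>I\<bar> \<noteq> \<infinity>" and ij: "i \<noteq> j" and strict: "strictly_supermodular_in F i j"
  proof -
    have fin: "e u < \<infinity>" "e v < \<infinity>" "p u < \<infinity>"
      using that(1,2) nu unfolding I I'
      by (cases "e u"; cases "e v"; cases "p u"; cases "n u"; simp)+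
    then have "e u = e v"
      using that(1) nu unfolding I I'
      by (cases "e u"; cases "e v"; cases "p u"; cases "n u"; simp)
    have "(\<lambda>x. ?\<Phi> (\<chi> i. u i x)) \<in> borel_measurable M"
    proof -
      have [measurable]: "(\<lambda>x. F (\<chi> i. u i x)) \<in> borel_measurable M"
        "(\<lambda>x. F (axis i (u i x))) \<in> borel_measurable M" for i
        by (intro borel_measurable_on_cone borel_measurable_axis F u; assumption)+
      show ?thesis unfolding excess_def by simp
    qed
    then obtain E where "AE x in M. x \<in> E"
      "\<And>x x'. x \<in> E \<Longrightarrow> x' \<in> E \<Longrightarrow> (u i x - u i x') * (u j x - u j x') \<ge> 0"
      using C.equality_imp_ordered[OF \<Phi> strictly_supermodular_excess[OF strict ij]]
        \<open>e u = e v\<close> fin(2) unfolding e_def by blast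
    then show ?thesis by blast
  qed
qed

text \<open>
  If \<open>f\<close> is strictly decreasing in the radius, then ordering \<open>g\<close> like \<open>f\<close> means that \<open>g\<close> is
  nonincreasing in the radius.
\<close>

lemma (in radial_space) ordered_with_radial_imp_rearrangement:
  assumes g: "vanishing_function X g" and nonneg: "\<And>x. x \<in> space M \<Longrightarrow> 0 \<le> g x"
    and f: "AE x in M. f x = k x" and k: "strictly_radially_decreasing X k"
    and E: "AE x in M. x \<in> E"
    and ordered: "\<forall>x\<in>E. \<forall>x'\<in>E. (f x - f x') * (g x - g x') \<ge> 0"
  shows "AE x in M. g x = rearrangement X g x"
proof -
  interpret g: vanishing_function X g by fact
  have "{x \<in> space M. radius x = radius (basepoint X)} \<in> null_sets M"
  proof (rule null_setsI)
    show "emeasure M {x \<in> space M. radius x = radius (basepoint X)} = 0"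
      using null_sphere[of "radius (basepoint X)"] by (simp add: radius_def)
  qed measurable
  from AE_not_in[OF this] have away: "AE x in M. x \<in> space M \<and> x \<noteq> basepoint X"
    using AE_space by eventually_elim auto
  show ?thesis
  proof (rule g.radially_ordered_imp_eq_rearrangement[OF nonneg])
    show "AE x in M. x \<in> {x \<in> E. f x = k x \<and> x \<in> space M \<and> x \<noteq> basepoint X}"
      using E f away by eventually_elim simp
    show "g x' \<le> g x"
      if x: "x \<in> {x \<in> E. f x = k x \<and> x \<in> space M \<and> x \<noteq> basepoint X}"
        and x': "x' \<in> {x \<in> E. f x = k x \<and> x \<in> space M \<and> x \<noteq> basepoint X}"
        and less: "enclosed x < enclosed x'" for x x'
    proof -
      have "radius x < radius x'"
        using monoD[OF mono_ball_volume, of "radius x'" "radius x"] less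
        by (force simp: enclosed_def)
      then have "f x' < f x"
        using k x x' unfolding strictly_radially_decreasing_def radius_def by auto
      moreover have "(f x - f x') * (g x - g x') \<ge> 0"
        using ordered x x' by blast
      ultimately show ?thesis
        by (simp add: zero_le_mult_iff)
    qed
  qed
qed

theorem theorem1:
  fixes X :: "'a pointed_space"
    and F :: "real ^ 'm \<Rightarrow> real"
    and u :: "'m \<Rightarrow> 'a \<Rightarrow> real"
  assumes "isomorphic X (euclidean_model :: (real ^ 'n) pointed_space)
         \<or> isomorphic X (spherical_model :: ((real ^ 'n) \<times> real) pointed_space)
         \<or> isomorphic X (hyperbolic_model :: (real ^ 'n) pointed_space)"
    and "supermodular F"
    and "F \<in> borel_measurable (restrict_space borel nonneg_cone)"
    and "F 0 = 0"
    and "\<And>i. u i \<in> borel_measurable (volume X)"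
    and "\<And>i x. x \<in> points X \<Longrightarrow> 0 \<le> u i x"
    and "\<And>i. vanishes_at_infinity X (u i)"
    and "\<And>i. (\<integral>\<^sup>+x. ennreal (max (- F (u i x *\<^sub>R axis i 1)) 0) \<partial>volume X) < \<infinity>"
  defines "I \<equiv> extended_integral (volume X) (\<lambda>x. F (\<chi> i. u i x))"
    and "I' \<equiv> extended_integral (volume X) (\<lambda>x. F (\<chi> i. rearrangement X (u i) x))"
  shows "(\<integral>\<^sup>+x. ennreal (- F (\<chi> i. u i x)) \<partial>volume X) < \<infinity> \<and>
    (\<integral>\<^sup>+x. ennreal (- F (\<chi> i. rearrangement X (u i) x)) \<partial>volume X) < \<infinity> \<and>
    I \<le> I' \<and>
    (I = I' \<and> \<bar>I\<bar> \<noteq> \<infinity> \<and> \<bar>I'\<bar> \<noteq> \<infinity> \<longrightarrow>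
      (\<forall>i j. i \<noteq> j \<and> strictly_supermodular_in F i j \<longrightarrow>
        (AE (x, x') in volume X \<Otimes>\<^sub>M volume X. (u i x - u i x') * (u j x - u j x') \<ge> 0) \<and>
        ((AE x in volume X. u i x = rearrangement X (u i) x) \<and>
           strictly_radially_decreasing X (rearrangement X (u i)) \<longrightarrow>
         (AE x in volume X. u j x = rearrangement X (u j) x))))"
proof -
  have "radial_space X"
    using assms(1)
    by (elim disjE radial_space_isomorphic)
       (rule radial_space_euclidean radial_space_spherical radial_space_hyperbolic)+
  then interpret radial_space X .
  have neg: "(\<integral>\<^sup>+x. ennreal (- F (axis i (u i x))) \<partial>M) < \<infinity>" for i
  proof -
    have "t *\<^sub>R axis i 1 = (axis i t :: real ^ 'm)" for t
      by (simp add: vec_eq_iff axis_def)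
    moreover have "ennreal (max t 0) = ennreal t" for t
      by (simp add: max_def ennreal_neg)
    ultimately show ?thesis
      using assms(8)[of i] by simp
  qed
  note hyps = assms(2,3,4,5,6,7) neg
  have ordered: "\<exists>E. (AE x in M. x \<in> E) \<and>
      (\<forall>x\<in>E. \<forall>x'\<in>E. (u i x - u i x') * (u j x - u j x') \<ge> 0)"
    if "I = I'" "\<bar>I\<bar> \<noteq> \<infinity>" "i \<noteq> j" "strictly_supermodular_in F i j" for i j
    by (rule equality_ordered[OF hyps]) (use that in \<open>simp_all add: I_def I'_def\<close>)
  show ?thesis
  proof (intro conjI impI allI; (elim conjE)?)
    show "(\<integral>\<^sup>+x. ennreal (- F (\<chi> i. u i x)) \<partial>M) < \<infinity>"
      by (rule negative_part_finite[OF hyps])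
    show "(\<integral>\<^sup>+x. ennreal (- F (\<chi> i. rearrangement X (u i) x)) \<partial>M) < \<infinity>"
      by (rule negative_part_rearrangement_finite[OF hyps])
    show "I \<le> I'"
      unfolding I_def I'_def by (rule rearrangement_inequality[OF hyps])
  next
    fix i j
    assume "I = I'" "\<bar>I\<bar> \<noteq> \<infinity>" "i \<noteq> j" "strictly_supermodular_in F i j"
    from ordered[OF this] obtain E where E: "AE x in M. x \<in> E"
      "\<forall>x\<in>E. \<forall>x'\<in>E. (u i x - u i x') * (u j x - u j x') \<ge> 0"
      by blast
    have "AE z in M \<Otimes>\<^sub>M M. fst z \<in> E \<and> snd z \<in> E"
      by (rule sigma_finite_measure.AE_pair_both[OF sigma_finite E(1)])
    then show "AE (x, x') in M \<Otimes>\<^sub>M M. (u i x - u i x') * (u j x - u j x') \<ge> 0"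
      by eventually_elim (use E(2) in auto)
  next
    fix i j
    assume eq: "I = I'" "\<bar>I\<bar> \<noteq> \<infinity>" "i \<noteq> j" "strictly_supermodular_in F i j"
      and radial: "AE x in M. u i x = rearrangement X (u i) x"
        "strictly_radially_decreasing X (rearrangement X (u i))"
    from ordered[OF eq] obtain E where E: "AE x in M. x \<in> E"
      "\<forall>x\<in>E. \<forall>x'\<in>E. (u i x - u i x') * (u j x - u j x') \<ge> 0"
      by blast
    have "vanishing_function X (u j)"
      by unfold_locales (use assms(5,7) in auto)
    then show "AE x in M. u j x = rearrangement X (u j) x"
      by (rule ordered_with_radial_imp_rearrangement[OF _ assms(6) radial E])
  qed
qed

end
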